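(* Any group $G$ possessing a finite index subgroup that embeds in a right angled Artin group or in a right angled Coxeter group has property (VRC).
   Context: A subgroup $H$ of a group $K$ is a retract of $K$ if there is a homomorphism $\rho: K \to H$ which restricts to the identity map on $H$. A subgroup $H$ of a group $G$ is a virtual retract of $G$ if there exists a subgroup $K \leqslant G$ with $|G:K|<\infty$, $H \subseteq K$, and $H$ a retract of $K$. A group $G$ has property (VRC) if every cyclic subgroup of $G$ is a virtual retract of $G$. Given a simplicial graph $\Gamma$ with vertex set $V\Gamma$ and edge set $E\Gamma$ and a family of groups $\mathfrak{G}=\{G_v\}_{v\in V\Gamma}$, the graph product $\Gamma\mathfrak{G}$ is the quotient of the free product $\ast_{v\in V\Gamma}G_v$ by the relations $[g_u,g_v]=1$ for all $g_u\in G_u$, $g_v\in G_v$ whenever $(u,v)\in E\Gamma$. A right angled Artin group is a graph product with all $G_v\cong\mathbb{Z}$; a right angled Coxeter group is a graph product with all $G_v\cong\mathbb{Z}/2\mathbb{Z}$. *)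

theory Defs
  imports "HOL-Algebra.Elementary_Groups"
begin

section \<open>Virtual retracts and property (VRC)\<close>

definition group_retract :: "'a set \<Rightarrow> ('a, 'm) monoid_scheme \<Rightarrow> bool" where
  "group_retract H K \<longleftrightarrow>
     subgroup H K \<and> (\<exists>\<rho> \<in> hom K (K\<lparr>carrier := H\<rparr>). \<forall>h\<in>H. \<rho> h = h)"

text \<open>Finiteness of an index is stated as finiteness of the set of cosets, because
  the cardinality of an infinite set is 0 in HOL.\<close>

definition virtual_retract :: "'a set \<Rightarrow> ('a, 'm) monoid_scheme \<Rightarrow> bool" where
  "virtual_retract H G \<longleftrightarrow>
     subgroup H G \<and>
     (\<exists>K. subgroup K G \<and> finite (rcosets\<^bsub>G\<^esub> K) \<and> H \<subseteq> K \<and> group_retract H (G\<lparr>carrier := K\<rparr>))"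

definition property_VRC :: "('a, 'm) monoid_scheme \<Rightarrow> bool" where
  "property_VRC G \<longleftrightarrow>
     (\<forall>C. subgroup C G \<and> cyclic_group (G\<lparr>carrier := C\<rparr>) \<longrightarrow> virtual_retract C G)"


section \<open>Free products\<close>

text \<open>The free product of the groups \<open>F v\<close>, \<open>v \<in> V\<close>, consists of words in the disjoint union
  of the factors. Words are identified by the congruence that deletes identity letters and
  multiplies adjacent letters from the same factor.\<close>

definition free_words :: "'v set \<Rightarrow> ('v \<Rightarrow> 'b monoid) \<Rightarrow> ('v \<times> 'b) list set" where
  "free_words V F = lists (SIGMA v:V. carrier (F v))"

inductive_set free_rel ::
  "'v set \<Rightarrow> ('v \<Rightarrow> 'b monoid) \<Rightarrow> (('v \<times> 'b) list \<times> ('v \<times> 'b) list) set"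
  for V :: "'v set" and F :: "'v \<Rightarrow> 'b monoid" where
  refl: "w \<in> free_words V F \<Longrightarrow> (w, w) \<in> free_rel V F"
| sym: "(w, w') \<in> free_rel V F \<Longrightarrow> (w', w) \<in> free_rel V F"
| trans: "(w, w') \<in> free_rel V F \<Longrightarrow> (w', w'') \<in> free_rel V F \<Longrightarrow> (w, w'') \<in> free_rel V F"
| one: "x \<in> free_words V F \<Longrightarrow> y \<in> free_words V F \<Longrightarrow> v \<in> V \<Longrightarrow>
    (x @ [(v, \<one>\<^bsub>F v\<^esub>)] @ y, x @ y) \<in> free_rel V F"
| mult: "x \<in> free_words V F \<Longrightarrow> y \<in> free_words V F \<Longrightarrow> v \<in> V \<Longrightarrow>
    a \<in> carrier (F v) \<Longrightarrow> b \<in> carrier (F v) \<Longrightarrow>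
    (x @ [(v, a), (v, b)] @ y, x @ [(v, a \<otimes>\<^bsub>F v\<^esub> b)] @ y) \<in> free_rel V F"

definition free_product :: "'v set \<Rightarrow> ('v \<Rightarrow> 'b monoid) \<Rightarrow> ('v \<times> 'b) list set monoid" where
  "free_product V F =
     \<lparr>carrier = free_words V F // free_rel V F,
      monoid.mult = (\<lambda>X Y. \<Union>x\<in>X. \<Union>y\<in>Y. free_rel V F `` {x @ y}),
      one = free_rel V F `` {[]}\<rparr>"

definition free_incl :: "'v set \<Rightarrow> ('v \<Rightarrow> 'b monoid) \<Rightarrow> 'v \<Rightarrow> 'b \<Rightarrow> ('v \<times> 'b) list set" where
  "free_incl V F v a = free_rel V F `` {[(v, a)]}"


section \<open>Graph products\<close>

text \<open>An edge joining \<open>u\<close> and \<open>v\<close> is represented by both ordered pairs. The graph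
  may be infinite.\<close>

definition simplicial_graph :: "'v set \<Rightarrow> ('v \<times> 'v) set \<Rightarrow> bool" where
  "simplicial_graph V E \<longleftrightarrow> E \<subseteq> V \<times> V \<and> sym E \<and> irrefl E"

definition commutator :: "('a, 'm) monoid_scheme \<Rightarrow> 'a \<Rightarrow> 'a \<Rightarrow> 'a" where
  "commutator G x y = x \<otimes>\<^bsub>G\<^esub> y \<otimes>\<^bsub>G\<^esub> inv\<^bsub>G\<^esub> x \<otimes>\<^bsub>G\<^esub> inv\<^bsub>G\<^esub> y"

definition normal_closure :: "('a, 'm) monoid_scheme \<Rightarrow> 'a set \<Rightarrow> 'a set" where
  "normal_closure G S = generate G {g \<otimes>\<^bsub>G\<^esub> s \<otimes>\<^bsub>G\<^esub> inv\<^bsub>G\<^esub> g | g s. g \<in> carrier G \<and> s \<in> S}"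

definition graph_relators ::
  "'v set \<Rightarrow> ('v \<times> 'v) set \<Rightarrow> ('v \<Rightarrow> 'b monoid) \<Rightarrow> ('v \<times> 'b) list set set" where
  "graph_relators V E F =
     {commutator (free_product V F) (free_incl V F u a) (free_incl V F v b) | u v a b.
        (u, v) \<in> E \<and> a \<in> carrier (F u) \<and> b \<in> carrier (F v)}"

definition graph_product ::
  "'v set \<Rightarrow> ('v \<times> 'v) set \<Rightarrow> ('v \<Rightarrow> 'b monoid) \<Rightarrow> ('v \<times> 'b) list set set monoid" where
  "graph_product V E F =
     free_product V F Mod normal_closure (free_product V F) (graph_relators V E F)"

definition right_angled_Artin_group :: "('v \<times> 'b) list set set monoid \<Rightarrow> bool" where
  "right_angled_Artin_group A \<longleftrightarrow>
     (\<exists>V E F. simplicial_graph V E \<and> (\<forall>v\<in>V. group (F v) \<and> F v \<cong> integer_group) \<and>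
        A = graph_product V E F)"

definition right_angled_Coxeter_group :: "('v \<times> 'b) list set set monoid \<Rightarrow> bool" where
  "right_angled_Coxeter_group A \<longleftrightarrow>
     (\<exists>V E F. simplicial_graph V E \<and> (\<forall>v\<in>V. group (F v) \<and> F v \<cong> integer_mod_group 2) \<and>
        A = graph_product V E F)"


section \<open>Free products and graph products are groups\<close>

lemma free_words_simps [simp]:
  "[] \<in> free_words V F"
  "p # w \<in> free_words V F \<longleftrightarrow> fst p \<in> V \<and> snd p \<in> carrier (F (fst p)) \<and> w \<in> free_words V F"
  "x @ y \<in> free_words V F \<longleftrightarrow> x \<in> free_words V F \<and> y \<in> free_words V F"
  by (cases p; auto simp: free_words_def)+

context
  fixes V :: "'v set" and F :: "'v \<Rightarrow> 'b monoid"
  assumes grp: "\<And>v. v \<in> V \<Longrightarrow> group (F v)"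
begin

lemma free_rel_words:
  assumes "(w, w') \<in> free_rel V F"
  shows "w \<in> free_words V F \<and> w' \<in> free_words V F"
  using assms
  by induction (auto simp: grp group.is_monoid monoid.one_closed monoid.m_closed)

lemma equiv_free_rel: "equiv (free_words V F) (free_rel V F)"
  by (rule equivI) (use free_rel_words in
      \<open>auto intro!: refl_onI symI transI intro: free_rel.refl free_rel.sym free_rel.trans\<close>)

lemma free_rel_context:
  assumes "(w, w') \<in> free_rel V F" "p \<in> free_words V F" "q \<in> free_words V F"
  shows "(p @ w @ q, p @ w' @ q) \<in> free_rel V F"
  using assms(1)
proof induction
  case (refl w) then show ?case using assms by (intro free_rel.refl) auto
next
  case (sym w w') then show ?case by (rule_tac free_rel.sym)
next
  case (trans w w' w'') show ?case by (rule free_rel.trans[OF trans.IH])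
next
  case (one x y v)
  then show ?case using free_rel.one[of "p @ x" V F "y @ q" v] assms by simp
next
  case (mult x y v a b)
  then show ?case using free_rel.mult[of "p @ x" V F "y @ q" v a b] assms by simp
qed

lemma free_rel_append:
  assumes "(x, x') \<in> free_rel V F" "(y, y') \<in> free_rel V F"
  shows "(x @ y, x' @ y') \<in> free_rel V F"
proof (rule free_rel.trans)
  show "(x @ y, x' @ y) \<in> free_rel V F"
    using free_rel_context[OF assms(1), of "[]" y] free_rel_words[OF assms(2)] by simp
  show "(x' @ y, x' @ y') \<in> free_rel V F"
    using free_rel_context[OF assms(2), of x' "[]"] free_rel_words[OF assms(1)] by simp
qed

lemma free_product_mult:
  assumes "x \<in> free_words V F" "y \<in> free_words V F"
  shows "(free_rel V F `` {x}) \<otimes>\<^bsub>free_product V F\<^esub> (free_rel V F `` {y}) = free_rel V F `` {x @ y}"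
proof -
  have "congruent2 (free_rel V F) (free_rel V F) (\<lambda>x y. free_rel V F `` {x @ y})"
    by (auto simp: congruent2_def intro!: equiv_class_eq[OF equiv_free_rel] free_rel_append)
  from UN_equiv_class2[OF equiv_free_rel equiv_free_rel this assms]
  show ?thesis by (simp add: free_product_def)
qed

lemma free_product_left_inv:
  assumes "w \<in> free_words V F"
  shows "\<exists>w' \<in> free_words V F. (w' @ w, []) \<in> free_rel V F"
  using assms
proof (induction w)
  case Nil then show ?case using free_rel.refl by force
next
  case (Cons p w)
  then obtain w' where w': "w' \<in> free_words V F" "(w' @ w, []) \<in> free_rel V F" by auto
  obtain v a where p: "p = (v, a)" by fastforce
  with Cons.prems have v: "v \<in> V" and a: "a \<in> carrier (F v)" and w: "w \<in> free_words V F" by auto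
  interpret Fv: group "F v" using grp v .
  let ?i = "inv\<^bsub>F v\<^esub> a"
  have "(w' @ [(v, ?i), (v, a)] @ w, w' @ [(v, ?i \<otimes>\<^bsub>F v\<^esub> a)] @ w) \<in> free_rel V F"
    using w' w v a by (intro free_rel.mult) auto
  moreover have "(w' @ [(v, ?i \<otimes>\<^bsub>F v\<^esub> a)] @ w, w' @ w) \<in> free_rel V F"
    using free_rel.one[OF w'(1) w v] a by simp
  ultimately have "((w' @ [(v, ?i)]) @ p # w, []) \<in> free_rel V F"
    using w'(2) p by (auto intro: free_rel.trans)
  then show ?case using w' v a by (intro bexI[of _ "w' @ [(v, ?i)]"]) auto
qed

lemma group_free_product: "group (free_product V F)"
proof (rule groupI)
  have car: "carrier (free_product V F) = free_words V F // free_rel V F"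
    and one: "\<one>\<^bsub>free_product V F\<^esub> = free_rel V F `` {[]}"
    by (auto simp: free_product_def)
  show "\<one>\<^bsub>free_product V F\<^esub> \<in> carrier (free_product V F)"
    by (simp add: car one quotientI)
  fix X assume "X \<in> carrier (free_product V F)"
  then obtain x where x: "x \<in> free_words V F" "X = free_rel V F `` {x}"
    by (auto simp: car elim: quotientE)
  show "\<one>\<^bsub>free_product V F\<^esub> \<otimes>\<^bsub>free_product V F\<^esub> X = X"
    using x by (simp add: one free_product_mult)
  obtain x' where x': "x' \<in> free_words V F" "(x' @ x, []) \<in> free_rel V F"
    using free_product_left_inv[OF x(1)] by blast
  then have "(free_rel V F `` {x'}) \<otimes>\<^bsub>free_product V F\<^esub> X = \<one>\<^bsub>free_product V F\<^esub>"
    using x by (simp add: one free_product_mult equiv_class_eq[OF equiv_free_rel])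
  then show "\<exists>Y\<in>carrier (free_product V F).
      Y \<otimes>\<^bsub>free_product V F\<^esub> X = \<one>\<^bsub>free_product V F\<^esub>"
    using x' by (intro bexI) (auto simp: car quotientI)
  fix Y assume "Y \<in> carrier (free_product V F)"
  then obtain y where y: "y \<in> free_words V F" "Y = free_rel V F `` {y}"
    by (auto simp: car elim: quotientE)
  show "X \<otimes>\<^bsub>free_product V F\<^esub> Y \<in> carrier (free_product V F)"
    using x y by (simp add: free_product_mult car quotientI)
  fix Z assume "Z \<in> carrier (free_product V F)"
  then obtain z where z: "z \<in> free_words V F" "Z = free_rel V F `` {z}"
    by (auto simp: car elim: quotientE)
  show "X \<otimes>\<^bsub>free_product V F\<^esub> Y \<otimes>\<^bsub>free_product V F\<^esub> Z =
      X \<otimes>\<^bsub>free_product V F\<^esub> (Y \<otimes>\<^bsub>free_product V F\<^esub> Z)"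
    using x y z by (simp add: free_product_mult)
qed

lemma free_incl_hom: "v \<in> V \<Longrightarrow> free_incl V F v \<in> hom (F v) (free_product V F)"
proof (rule homI)
  fix a b assume v: "v \<in> V" and a: "a \<in> carrier (F v)" and b: "b \<in> carrier (F v)"
  have "([(v, a), (v, b)], [(v, a \<otimes>\<^bsub>F v\<^esub> b)]) \<in> free_rel V F"
    using free_rel.mult[of "[]" V F "[]" v a b] v a b by simp
  from equiv_class_eq[OF equiv_free_rel this]
  show "free_incl V F v (a \<otimes>\<^bsub>F v\<^esub> b) = free_incl V F v a \<otimes>\<^bsub>free_product V F\<^esub> free_incl V F v b"
    using v a b by (simp add: free_incl_def free_product_mult)
qed (auto simp: free_incl_def free_product_def intro!: quotientI)

end

lemma (in group) normal_closure_normal: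
  assumes "S \<subseteq> carrier G"
  shows "normal_closure G S \<lhd> G"
  unfolding normal_closure_def
proof (rule normal_generateI)
  fix h g assume "h \<in> {g \<otimes> s \<otimes> inv g | g s. g \<in> carrier G \<and> s \<in> S}" and g: "g \<in> carrier G"
  then obtain k s where k: "k \<in> carrier G" "s \<in> S" "h = k \<otimes> s \<otimes> inv k" by auto
  with assms g have "g \<otimes> h \<otimes> inv g = (g \<otimes> k) \<otimes> s \<otimes> inv (g \<otimes> k)"
    by (auto simp: m_assoc inv_mult_group subset_iff)
  then show "g \<otimes> h \<otimes> inv g \<in> {g \<otimes> s \<otimes> inv g | g s. g \<in> carrier G \<and> s \<in> S}"
    using g k by blast
qed (use assms in auto)

lemma group_graph_product:
  assumes "simplicial_graph V E" "\<And>v. v \<in> V \<Longrightarrow> group (F v)"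
  shows "group (graph_product V E F)"
proof -
  interpret P: group "free_product V F" by (rule group_free_product[OF assms(2)])
  have "free_incl V F v a \<in> carrier (free_product V F)" if "v \<in> V" "a \<in> carrier (F v)" for v a
    using free_incl_hom[where V = V and F = F and v = v] assms(2) that by (auto simp: hom_def)
  then have "graph_relators V E F \<subseteq> carrier (free_product V F)"
    using assms(1) by (auto simp: graph_relators_def simplicial_graph_def commutator_def)
  then show ?thesis
    unfolding graph_product_def by (intro normal.factorgroup_is_group P.normal_closure_normal)
qed

end

(* Fix x in the right-angled group A. The heart is to find, unless x^2 = 1, a finite index subgroup
   of A containing x^2 and a homomorphism from it to the integers not killing x^2; this replaces
   any use of normal forms or cube complexes.

   In a right-angled Coxeter group give each generator its own type. Let w be a word in which every
   type occurs an even number of times. If a single generator v occurs an odd number of times,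
   then so does another generator v' of the same type; generators of equal type do not commute, so
   killing all the others maps the group onto the infinite dihedral group, where w becomes a
   nontrivial translation by a parity count. Otherwise pick a letter v of w and pass to the
   kernel of the map onto <v>, of index 2. It is again right-angled Coxeter, generated by the s and
   the v s v (the same generator if s and v commute) with inherited types, and w becomes shorter.
   If the first case never
   occurs, one ends with the empty word, so w represents 1. An x with an odd type is excluded by
   the map onto Z/2 counting that type, so A is also residually finite.

   A right-angled Artin group embeds into a right-angled Coxeter group by sending v to a product
   r'_v r_v of two involutions: r_v acts on A as the automorphism inverting v, and r'_v as that
   automorphism followed by left multiplication by v.

   Finally let G be virtually embedded in A. A finite cyclic subgroup is a virtual retract by
   residual finiteness. For g of infinite order take a character of a normal finite index subgroup
   N that is nonzero on a power of g and average it over conjugation by the powers of g: its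
   kernel is normalised by g, meets <g> trivially and has finite index product with <g>. *)

theory Submission
  imports Defs "HOL-Algebra.Bij"
begin

section \<open>Finite index and virtual retracts\<close>

definition finite_index :: "'a set \<Rightarrow> ('a, 'm) monoid_scheme \<Rightarrow> bool" where
  "finite_index K G \<longleftrightarrow> subgroup K G \<and> finite (rcosets\<^bsub>G\<^esub> K)"

text \<open>Values outside \<open>K\<close> are unconstrained, so the same function serves as a
  character of every smaller subgroup.\<close>

definition integer_character :: "'a set \<Rightarrow> ('a, 'm) monoid_scheme \<Rightarrow> ('a \<Rightarrow> int) \<Rightarrow> bool" where
  "integer_character K G \<phi> \<longleftrightarrow> (\<forall>a\<in>K. \<forall>b\<in>K. \<phi> (a \<otimes>\<^bsub>G\<^esub> b) = \<phi> a + \<phi> b)"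

definition virtually_detected :: "('a, 'm) monoid_scheme \<Rightarrow> 'a \<Rightarrow> bool" where
  "virtually_detected G x \<longleftrightarrow>
     (\<exists>K \<phi>. finite_index K G \<and> integer_character K G \<phi> \<and> x \<in> K \<and> \<phi> x \<noteq> 0)"

definition residually_finite :: "('a, 'm) monoid_scheme \<Rightarrow> bool" where
  "residually_finite G \<longleftrightarrow>
     (\<forall>x\<in>carrier G. x \<noteq> \<one>\<^bsub>G\<^esub> \<longrightarrow> (\<exists>K. finite_index K G \<and> x \<notin> K))"

section \<open>Calculus of finite index subgroups\<close>

context group
begin

lemma inv_cancel:
  assumes "x \<in> carrier G" "y \<in> carrier G"
  shows "inv x \<otimes> (x \<otimes> y) = y" "x \<otimes> (inv x \<otimes> y) = y"
  using assms by (simp_all add: m_assoc[symmetric])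

text \<open>By the last hypothesis the label \<open>c x\<close> determines the right coset of
  \<open>x\<close>, so the index is at most the number of labels. Later proofs take tuples of
  cosets, residues or orbit points as labels.\<close>

lemma finite_indexI:
  assumes K: "subgroup K G" and fin: "finite (c ` carrier G)"
    and c: "\<And>x y. x \<in> carrier G \<Longrightarrow> y \<in> carrier G \<Longrightarrow> c x = c y \<Longrightarrow> x \<otimes> inv y \<in> K"
  shows "finite_index K G"
proof -
  have "K #> x = K #> y" if "x \<in> carrier G" "y \<in> carrier G" "c x = c y" for x y
    using c[OF that] that K
    by (intro coset_mult_inv1) (auto simp: coset_join2 subgroup.subset)
  then have "K #> x = K #> (SOME y. y \<in> carrier G \<and> c y = c x)" if "x \<in> carrier G" for x
    using that by (smt (verit, best) someI_ex)
  then have "rcosets K \<subseteq> (\<lambda>z. K #> (SOME y. y \<in> carrier G \<and> c y = z)) ` c ` carrier G"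
    unfolding RCOSETS_def by auto
  with fin K show ?thesis
    unfolding finite_index_def by (meson finite_imageI finite_subset)
qed

lemma finite_index_finite_image:
  assumes "finite_index K G"
  shows "finite ((\<lambda>x. K #> x) ` carrier G)"
proof -
  have "(\<lambda>x. K #> x) ` carrier G = rcosets K" by (auto simp: RCOSETS_def)
  then show ?thesis using assms by (simp add: finite_index_def)
qed

lemma rcoset_eq_imp:
  assumes "subgroup K G" "x \<in> carrier G" "y \<in> carrier G" "K #> x = K #> y"
  shows "x \<otimes> inv y \<in> K"
proof -
  have "x \<in> K #> y" using assms rcos_self by blast
  then show ?thesis using assms subgroup.rcos_module_imp[OF assms(1) is_group assms(3)] by blast
qed

text \<open>Pigeonhole: two powers of \<open>x\<close> share a coset of \<open>K\<close>, and their
  quotient is a positive power lying in \<open>K\<close>.\<close>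

lemma finite_index_power:
  assumes "finite_index K G" "x \<in> carrier G"
  obtains n :: nat where "n > 0" "x [^] n \<in> K"
proof -
  have K: "subgroup K G" using assms(1) by (simp add: finite_index_def)
  have "(\<lambda>i::nat. K #> x [^] i) ` UNIV \<subseteq> (\<lambda>x. K #> x) ` carrier G" using assms(2) by auto
  then have "\<not> inj (\<lambda>i::nat. K #> x [^] i)"
    using finite_index_finite_image[OF assms(1)] finite_imageD finite_subset infinite_UNIV_nat by blast
  then obtain i j :: nat where "i < j" "K #> x [^] j = K #> x [^] i"
    unfolding inj_def by (metis linorder_neqE_nat)
  moreover from this have "x [^] j \<otimes> inv (x [^] i) \<in> K"
    using assms(2) by (intro rcoset_eq_imp[OF K]) auto
  moreover have "x [^] j = x [^] (j - i) \<otimes> x [^] i"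
    using \<open>i < j\<close> assms(2) by (simp add: nat_pow_mult)
  ultimately have "x [^] (j - i) \<in> K" using assms(2) by (simp add: m_assoc)
  with \<open>i < j\<close> show ?thesis by (intro that[of "j - i"]) auto
qed

lemma finite_index_mono:
  assumes "finite_index K G" "subgroup L G" "K \<subseteq> L"
  shows "finite_index L G"
proof (rule finite_indexI[OF assms(2) finite_index_finite_image[OF assms(1)]])
  show "x \<otimes> inv y \<in> L" if "x \<in> carrier G" "y \<in> carrier G" "K #> x = K #> y" for x y
    using rcoset_eq_imp[of K x y] that assms by (auto simp: finite_index_def)
qed

lemma finite_index_INT:
  assumes "finite I" "\<And>i. i \<in> I \<Longrightarrow> finite_index (K i) G"
  shows "finite_index (carrier G \<inter> (\<Inter>i\<in>I. K i)) G"
proof (rule finite_indexI)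
  have K: "subgroup (K i) G" if "i \<in> I" for i using assms(2)[OF that] by (simp add: finite_index_def)
  show "subgroup (carrier G \<inter> (\<Inter>i\<in>I. K i)) G"
  proof (rule subgroupI)
    have "\<one> \<in> carrier G \<inter> (\<Inter>i\<in>I. K i)" using K by (auto intro: subgroup.one_closed)
    then show "carrier G \<inter> (\<Inter>i\<in>I. K i) \<noteq> {}" by blast
  qed (use K in \<open>auto intro: subgroup.m_inv_closed subgroup.m_closed\<close>)
  let ?c = "\<lambda>x. \<lambda>i\<in>I. K i #> x"
  have "?c ` carrier G \<subseteq> (\<Pi>\<^sub>E i\<in>I. (\<lambda>x. K i #> x) ` carrier G)" by auto
  moreover have "finite (\<Pi>\<^sub>E i\<in>I. (\<lambda>x. K i #> x) ` carrier G)"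
    using assms by (intro finite_PiE finite_index_finite_image)
  ultimately show "finite (?c ` carrier G)" by (rule finite_subset)
  fix x y assume xy: "x \<in> carrier G" "y \<in> carrier G" "?c x = ?c y"
  have "x \<otimes> inv y \<in> K i" if "i \<in> I" for i
  proof -
    have "?c x i = ?c y i" using xy(3) by (rule fun_cong)
    then show ?thesis using that xy(1,2) rcoset_eq_imp[OF K[OF that]] by simp
  qed
  with xy show "x \<otimes> inv y \<in> carrier G \<inter> (\<Inter>i\<in>I. K i)" by auto
qed

text \<open>An element \<open>x\<close> is labelled by its coset of \<open>L\<close> and by the
  coset of \<open>K\<close> containing its quotient by a representative \<open>r x\<close> of
  \<open>L #> x\<close>. Equal first labels give equal representatives, which then cancel.\<close>

lemma finite_index_trans:
  assumes L: "finite_index L G" and K: "finite_index K (G\<lparr>carrier := L\<rparr>)"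
  shows "finite_index K G"
proof -
  let ?L = "G\<lparr>carrier := L\<rparr>"
  have sL: "subgroup L G" and sK: "subgroup K ?L" using L K by (auto simp: finite_index_def)
  interpret L: group ?L using sL by (rule subgroup_imp_group)
  define r where "r x = (SOME y. y \<in> L #> x)" for x
  have r: "r x \<in> carrier G" "x \<otimes> inv (r x) \<in> L" if "x \<in> carrier G" for x
  proof -
    have "r x \<in> L #> x" unfolding r_def using rcos_self[OF that sL] by (rule someI)
    then obtain l where l: "l \<in> L" "r x = l \<otimes> x" by (auto simp: r_coset_def)
    with that sL show "r x \<in> carrier G" by (auto dest: subgroup.mem_carrier)
    have lc: "l \<in> carrier G" using l sL by (auto dest: subgroup.mem_carrier)
    have "x \<otimes> inv (r x) = inv l" using l lc that by (simp add: inv_mult_group m_assoc[symmetric])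
    then show "x \<otimes> inv (r x) \<in> L" using l sL by (simp add: subgroup.m_inv_closed)
  qed
  let ?c = "\<lambda>x. (L #> x, K #> (x \<otimes> inv (r x)))"
  show ?thesis
  proof (rule finite_indexI)
    show sKG: "subgroup K G" using incl_subgroup[OF sL sK] .
    have "?c ` carrier G \<subseteq> (\<lambda>x. L #> x) ` carrier G \<times> (\<lambda>x. K #> x) ` L"
      using r(2) by auto
    moreover have "finite ((\<lambda>x. K #> x) ` L)"
      using L.finite_index_finite_image[OF K] by simp
    ultimately show "finite (?c ` carrier G)"
      using finite_index_finite_image[OF L] by (meson finite_SigmaI finite_subset)
    fix x y assume x: "x \<in> carrier G" and y: "y \<in> carrier G" and eq: "?c x = ?c y"
    then have "r x = r y" by (simp add: r_def)
    with eq have "(x \<otimes> inv (r x)) \<otimes> inv (y \<otimes> inv (r x)) \<in> K"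
      using r x y by (intro rcoset_eq_imp[OF sKG]) auto
    then show "x \<otimes> inv y \<in> K"
      using r(1)[OF x] x y by (simp add: inv_mult_group m_assoc inv_cancel)
  qed
qed

text \<open>\<open>?N\<close> is the kernel of the action on the cosets of \<open>K\<close> by right
  multiplication; a finite set of cosets has only finitely many self-maps.\<close>

lemma finite_index_core:
  assumes "finite_index K G"
  obtains N where "N \<lhd> G" "finite_index N G" "N \<subseteq> K"
proof -
  have K: "subgroup K G" using assms by (simp add: finite_index_def)
  let ?N = "{x \<in> carrier G. \<forall>g\<in>carrier G. g \<otimes> x \<otimes> inv g \<in> K}"
  have sN: "subgroup ?N G"
  proof (rule subgroupI)
    show "?N \<noteq> {}" using subgroup.one_closed[OF K] by (auto intro!: exI[of _ \<one>])
    show "inv a \<in> ?N" if "a \<in> ?N" for a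
    proof -
      have "g \<otimes> inv a \<otimes> inv g = inv (g \<otimes> a \<otimes> inv g)" if "g \<in> carrier G" for g
        using that \<open>a \<in> ?N\<close> by (simp add: inv_mult_group m_assoc)
      with that show ?thesis using subgroup.m_inv_closed[OF K] by auto
    qed
    show "a \<otimes> b \<in> ?N" if "a \<in> ?N" "b \<in> ?N" for a b
    proof -
      have "g \<otimes> (a \<otimes> b) \<otimes> inv g = (g \<otimes> a \<otimes> inv g) \<otimes> (g \<otimes> b \<otimes> inv g)" if "g \<in> carrier G" for g
        using that \<open>a \<in> ?N\<close> \<open>b \<in> ?N\<close> by (simp add: m_assoc inv_cancel)
      with that show ?thesis using subgroup.m_closed[OF K] by auto
    qed
  qed auto
  have "?N \<lhd> G"
  proof (rule normal_invI[OF sN])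
    fix x h assume x: "x \<in> carrier G" and h: "h \<in> ?N"
    have "g \<otimes> (x \<otimes> h \<otimes> inv x) \<otimes> inv g = (g \<otimes> x) \<otimes> h \<otimes> inv (g \<otimes> x)" if "g \<in> carrier G" for g
      using that x h by (simp add: m_assoc inv_mult_group)
    with x h show "x \<otimes> h \<otimes> inv x \<in> ?N" by auto
  qed
  moreover have "finite_index ?N G"
  proof (rule finite_indexI[OF sN])
    let ?c = "\<lambda>x. \<lambda>C\<in>rcosets K. C #> x"
    have sub: "C \<subseteq> carrier G" if "C \<in> rcosets K" for C
      using that K subgroup.rcosets_carrier is_group by blast
    have "C #> x \<in> rcosets K" if "C \<in> rcosets K" "x \<in> carrier G" for C x
      using that K unfolding RCOSETS_def
      by (auto simp: coset_mult_assoc subgroup.subset)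
    then have "?c ` carrier G \<subseteq> (\<Pi>\<^sub>E C\<in>rcosets K. rcosets K)" by auto
    moreover have "finite (\<Pi>\<^sub>E C\<in>rcosets K. rcosets K)"
      using assms by (intro finite_PiE) (auto simp: finite_index_def)
    ultimately show "finite (?c ` carrier G)" by (rule finite_subset)
    fix x y assume x: "x \<in> carrier G" and y: "y \<in> carrier G" and eq: "?c x = ?c y"
    have "g \<otimes> (x \<otimes> inv y) \<otimes> inv g \<in> K" if g: "g \<in> carrier G" for g
    proof -
      have "K #> g \<in> rcosets K" using g by (auto simp: RCOSETS_def)
      from fun_cong[OF eq, of "K #> g"] this have "K #> (g \<otimes> x) = K #> (g \<otimes> y)"
        using g x y K by (simp add: coset_mult_assoc subgroup.subset)
      then have "(g \<otimes> x) \<otimes> inv (g \<otimes> y) \<in> K"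
        using g x y by (intro rcoset_eq_imp[OF K]) auto
      then show ?thesis using g x y by (simp add: m_assoc inv_mult_group)
    qed
    with x y show "x \<otimes> inv y \<in> ?N" by auto
  qed
  moreover have "?N \<subseteq> K"
    by (auto dest: bspec[of _ _ \<one>])
  ultimately show ?thesis using that by blast
qed

end

lemma (in group_hom) finite_index_vimage:
  assumes "finite_index K H"
  shows "finite_index {x \<in> carrier G. h x \<in> K} G"
proof (rule G.finite_indexI)
  have K: "subgroup K H" using assms by (simp add: finite_index_def)
  show "subgroup {x \<in> carrier G. h x \<in> K} G"
    using K by (intro G.subgroupI) (auto intro: subgroup.m_closed subgroup.m_inv_closed subgroup.one_closed
        intro!: exI[of _ "\<one>\<^bsub>G\<^esub>"])
  have "(\<lambda>x. K #>\<^bsub>H\<^esub> h x) ` carrier G \<subseteq> (\<lambda>x. K #>\<^bsub>H\<^esub> x) ` carrier H" by auto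
  then show "finite ((\<lambda>x. K #>\<^bsub>H\<^esub> h x) ` carrier G)"
    using H.finite_index_finite_image[OF assms] by (rule finite_subset)
  show "x \<otimes> inv y \<in> {x \<in> carrier G. h x \<in> K}"
    if "x \<in> carrier G" "y \<in> carrier G" "K #>\<^bsub>H\<^esub> h x = K #>\<^bsub>H\<^esub> h y" for x y
    using that H.rcoset_eq_imp[OF K, of "h x" "h y"] by auto
qed

section \<open>Integer characters on subgroups\<close>

context group
begin

lemma integer_character_group_hom:
  assumes "subgroup K G" "integer_character K G \<phi>"
  shows "group_hom (G\<lparr>carrier := K\<rparr>) integer_group \<phi>"
  using assms subgroup_imp_group[OF assms(1)]
  by (auto simp: group_hom_def group_hom_axioms_def hom_def integer_character_def)

lemma integer_character_simps:
  assumes "subgroup K G" "integer_character K G \<phi>"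
  shows "\<phi> \<one> = 0" "a \<in> K \<Longrightarrow> b \<in> K \<Longrightarrow> \<phi> (a \<otimes> b) = \<phi> a + \<phi> b"
    "a \<in> K \<Longrightarrow> \<phi> (inv a) = - \<phi> a" "a \<in> K \<Longrightarrow> \<phi> (a [^] (k :: int)) = k * \<phi> a"
proof -
  interpret h: group_hom "G\<lparr>carrier := K\<rparr>" integer_group \<phi>
    using assms by (rule integer_character_group_hom)
  show "\<phi> \<one> = 0" using h.hom_one by simp
  show "a \<in> K \<Longrightarrow> b \<in> K \<Longrightarrow> \<phi> (a \<otimes> b) = \<phi> a + \<phi> b" using h.hom_mult[of a b] by simp
  show "a \<in> K \<Longrightarrow> \<phi> (inv a) = - \<phi> a"
    using h.hom_inv[of a] m_inv_consistent[OF assms(1)] by simp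
  show "a \<in> K \<Longrightarrow> \<phi> (a [^] k) = k * \<phi> a"
    using h.hom_int_pow[of a k] int_pow_consistent[OF assms(1)] by simp
qed

lemma finite_index_character_dvd:
  assumes K: "finite_index K G" and \<phi>: "integer_character K G \<phi>" and m: "m \<noteq> 0"
  shows "finite_index {x \<in> K. m dvd \<phi> x} G"
proof (rule finite_index_trans[OF K])
  have sK: "subgroup K G" using K by (simp add: finite_index_def)
  note \<phi>s = integer_character_simps[OF sK \<phi>]
  interpret K: group "G\<lparr>carrier := K\<rparr>" using sK by (rule subgroup_imp_group)
  show "finite_index {x \<in> K. m dvd \<phi> x} (G\<lparr>carrier := K\<rparr>)"
  proof (rule K.finite_indexI)
    show "subgroup {x \<in> K. m dvd \<phi> x} (G\<lparr>carrier := K\<rparr>)"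
      by (rule K.subgroupI)
        (use sK in \<open>auto simp: \<phi>s m_inv_consistent[OF sK] subgroup.m_closed subgroup.m_inv_closed
          subgroup.one_closed intro!: exI[of _ \<one>]\<close>)
    have "(\<lambda>x. \<phi> x mod m) ` carrier (G\<lparr>carrier := K\<rparr>) \<subseteq> (\<lambda>x. x mod m) ` UNIV" by auto
    moreover have "(\<lambda>x. x mod m) ` UNIV \<subseteq> {-\<bar>m\<bar>..\<bar>m\<bar>}"
    proof clarify
      fix x show "x mod m \<in> {-\<bar>m\<bar>..\<bar>m\<bar>}" using abs_mod_less[OF m, of x] by auto
    qed
    ultimately show "finite ((\<lambda>x. \<phi> x mod m) ` carrier (G\<lparr>carrier := K\<rparr>))"
      by (meson finite_atLeastAtMost_int finite_subset)
    fix x y assume "x \<in> carrier (G\<lparr>carrier := K\<rparr>)" "y \<in> carrier (G\<lparr>carrier := K\<rparr>)"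
      "\<phi> x mod m = \<phi> y mod m"
    then show "x \<otimes>\<^bsub>G\<lparr>carrier := K\<rparr>\<^esub> inv\<^bsub>G\<lparr>carrier := K\<rparr>\<^esub> y \<in> {x \<in> K. m dvd \<phi> x}"
      using sK by (auto simp: \<phi>s m_inv_consistent[OF sK] subgroup.m_closed subgroup.m_inv_closed
          mod_eq_dvd_iff)
  qed
qed

text \<open>A nonzero integer is not divisible by its absolute value plus one, so \<open>x\<close>
  survives in the reduction of its character modulo that number.\<close>

lemma virtually_detected_imp_excluded:
  assumes "virtually_detected G x"
  shows "\<exists>K. finite_index K G \<and> x \<notin> K"
proof -
  obtain K \<phi> where K: "finite_index K G" "integer_character K G \<phi>" "\<phi> x \<noteq> 0"
    using assms by (auto simp: virtually_detected_def)
  have "\<not> (\<bar>\<phi> x\<bar> + 1) dvd \<phi> x"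
    using K(3) by (auto dest: dvd_imp_le_int)
  with finite_index_character_dvd[OF K(1,2), of "\<bar>\<phi> x\<bar> + 1"] show ?thesis by force
qed

end

section \<open>Virtual retracts from complements\<close>

context group
begin

text \<open>\<open>C\<close> normalises \<open>N\<close> and meets it trivially, so
  \<open>N <#> C\<close> is an internal semidirect product whose projection to \<open>C\<close> is
  the retraction. \<open>K0\<close> witnesses that the product has finite index.\<close>

lemma virtual_retract_complement:
  assumes C: "subgroup C G" and N: "subgroup N G"
    and conj: "\<And>c n. c \<in> C \<Longrightarrow> n \<in> N \<Longrightarrow> c \<otimes> n \<otimes> inv c \<in> N"
    and triv: "N \<inter> C = {\<one>}"
    and K: "finite_index K0 G" "K0 \<subseteq> N <#> C"
  shows "virtual_retract C G"
proof -
  let ?K = "N <#> C"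
  \<comment> \<open>The choice is unique on \<open>N <#> C\<close> because \<open>N\<close> and
    \<open>C\<close> meet trivially.\<close>
  define \<rho> where "\<rho> x = (SOME c. c \<in> C \<and> x \<otimes> inv c \<in> N)" for x
  note Cc = subgroup.mem_carrier[OF C] and Nc = subgroup.mem_carrier[OF N]
  have \<rho>: "\<rho> (n \<otimes> c) = c" if n: "n \<in> N" and c: "c \<in> C" for n c
  proof -
    let ?d = "\<rho> (n \<otimes> c)"
    have "c \<in> C \<and> (n \<otimes> c) \<otimes> inv c \<in> N" using n c Cc Nc by (simp add: m_assoc)
    then have d: "?d \<in> C" "(n \<otimes> c) \<otimes> inv ?d \<in> N"
      unfolding \<rho>_def by (metis (mono_tags, lifting) someI_ex)+
    have "inv n \<otimes> ((n \<otimes> c) \<otimes> inv ?d) = c \<otimes> inv ?d"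
      using n c d Cc Nc by (simp add: m_assoc inv_cancel)
    then have "c \<otimes> inv ?d \<in> N \<inter> C"
      using subgroup.m_closed[OF N subgroup.m_inv_closed[OF N n] d(2)]
        subgroup.m_closed[OF C c subgroup.m_inv_closed[OF C d(1)]] by simp
    with triv have "c \<otimes> inv ?d = \<one>" by blast
    then show ?thesis using c d Cc by (simp add: inv_solve_right')
  qed
  have KE: "\<exists>n\<in>N. \<exists>c\<in>C. x = n \<otimes> c" if "x \<in> ?K" for x using that by (auto simp: set_mult_def)
  have KI: "n \<otimes> c \<in> ?K" if "n \<in> N" "c \<in> C" for n c using that by (auto simp: set_mult_def)
  have mult: "(n \<otimes> c) \<otimes> (n' \<otimes> c') = (n \<otimes> (c \<otimes> n' \<otimes> inv c)) \<otimes> (c \<otimes> c')"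
    if "n \<in> N" "c \<in> C" "n' \<in> N" "c' \<in> C" for n c n' c'
    using that by (simp add: m_assoc inv_cancel Cc Nc)
  have sK: "subgroup ?K G"
  proof (rule subgroupI)
    show "?K \<subseteq> carrier G" using Cc Nc by (auto simp: set_mult_def)
    show "?K \<noteq> {}" using KI[OF subgroup.one_closed[OF N] subgroup.one_closed[OF C]] by blast
    show "a \<otimes> b \<in> ?K" if "a \<in> ?K" "b \<in> ?K" for a b
    proof -
      obtain n c n' c' where nc: "n \<in> N" "c \<in> C" "a = n \<otimes> c" "n' \<in> N" "c' \<in> C" "b = n' \<otimes> c'"
        using KE \<open>a \<in> ?K\<close> \<open>b \<in> ?K\<close> by blast
      then show ?thesis
        using KI[OF subgroup.m_closed[OF N nc(1) conj[OF nc(2,4)]] subgroup.m_closed[OF C nc(2,5)]]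
        by (simp add: mult)
    qed
    show "inv a \<in> ?K" if "a \<in> ?K" for a
    proof -
      obtain n c where nc: "n \<in> N" "c \<in> C" "a = n \<otimes> c" using KE \<open>a \<in> ?K\<close> by blast
      then have "inv a = (inv c \<otimes> inv n \<otimes> inv (inv c)) \<otimes> inv c"
        by (simp add: m_assoc inv_mult_group Cc Nc)
      then show ?thesis
        using nc KI[OF conj[of "inv c" "inv n"], of "inv c"] C N by (simp add: subgroup.m_inv_closed)
    qed
  qed
  have CK: "C \<subseteq> ?K" using KI[OF subgroup.one_closed[OF N]] Cc by force
  interpret K: group "G\<lparr>carrier := ?K\<rparr>" using sK by (rule subgroup_imp_group)
  have "\<rho> \<in> hom (G\<lparr>carrier := ?K\<rparr>) (G\<lparr>carrier := C\<rparr>)"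
  proof (rule homI)
    fix x assume "x \<in> carrier (G\<lparr>carrier := ?K\<rparr>)"
    then show "\<rho> x \<in> carrier (G\<lparr>carrier := C\<rparr>)" using KE \<rho> by fastforce
  next
    fix x y assume "x \<in> carrier (G\<lparr>carrier := ?K\<rparr>)" "y \<in> carrier (G\<lparr>carrier := ?K\<rparr>)"
    then obtain n c n' c' where xy: "n \<in> N" "c \<in> C" "x = n \<otimes> c" "n' \<in> N" "c' \<in> C" "y = n' \<otimes> c'"
      using KE[of x] KE[of y] by auto
    then have "\<rho> (x \<otimes> y) = c \<otimes> c'"
      using mult \<rho> conj C N by (simp add: subgroup.m_closed)
    then show "\<rho> (x \<otimes>\<^bsub>G\<lparr>carrier := ?K\<rparr>\<^esub> y) = \<rho> x \<otimes>\<^bsub>G\<lparr>carrier := C\<rparr>\<^esub> \<rho> y"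
      using xy \<rho> by simp
  qed
  moreover have "\<rho> c = c" if "c \<in> C" for c
    using \<rho>[OF subgroup.one_closed[OF N] that] that Cc by simp
  moreover have "subgroup C (G\<lparr>carrier := ?K\<rparr>)"
    using C sK CK by (simp add: subgroup_incl)
  ultimately have "group_retract C (G\<lparr>carrier := ?K\<rparr>)"
    by (auto simp: group_retract_def)
  moreover have "finite (rcosets ?K)"
    using finite_index_mono[OF K(1) sK K(2)] by (simp add: finite_index_def)
  ultimately show ?thesis
    using C sK CK by (auto simp: virtual_retract_def)
qed

text \<open>Each nontrivial element of \<open>C\<close> is excluded by some finite index subgroup.
  These are finitely many, and a normal finite index subgroup inside their intersection is the
  required complement.\<close>

lemma virtual_retract_finite:
  assumes "residually_finite G" "subgroup C G" "finite C"
  shows "virtual_retract C G"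
proof -
  have "\<forall>c\<in>C - {\<one>}. \<exists>K. finite_index K G \<and> c \<notin> K"
    using assms(1) subgroup.mem_carrier[OF assms(2)] by (auto simp: residually_finite_def)
  then obtain K where K: "\<And>c. c \<in> C - {\<one>} \<Longrightarrow> finite_index (K c) G \<and> c \<notin> K c" by metis
  have "finite_index (carrier G \<inter> (\<Inter>c\<in>C - {\<one>}. K c)) G"
    using K assms(3) by (intro finite_index_INT) auto
  then obtain N where N: "N \<lhd> G" "finite_index N G" "N \<subseteq> carrier G \<inter> (\<Inter>c\<in>C - {\<one>}. K c)"
    by (rule finite_index_core)
  have sN: "subgroup N G" using N by (simp add: finite_index_def)
  have "\<one> \<in> N" "\<one> \<in> C" using sN assms(2) by (auto simp: subgroup.one_closed)
  with N(3) K have "N \<inter> C = {\<one>}" by blast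
  moreover have "N \<subseteq> N <#> C"
    using \<open>\<one> \<in> C\<close> subgroup.mem_carrier[OF sN] by (force simp: set_mult_def)
  moreover have "c \<otimes> n \<otimes> inv c \<in> N" if "c \<in> C" "n \<in> N" for c n
    using that N(1) subgroup.mem_carrier[OF assms(2)] normal.inv_op_closed2 by metis
  ultimately show ?thesis
    using virtual_retract_complement[OF assms(2) sN] N(2) by blast
qed

text \<open>Summing \<open>\<phi>\<close> over conjugation by \<open>g [^] i\<close> for
  \<open>i < M\<close> gives a character \<open>\<psi>\<close> that is invariant under conjugation
  by \<open>g\<close> and still nonzero on \<open>g [^] M\<close>. Its kernel is the
  complement.\<close>

lemma virtual_retract_infinite_cyclic:
  fixes M :: nat
  assumes g: "g \<in> carrier G" and N: "N \<lhd> G" "finite_index N G"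
    and \<phi>: "integer_character N G \<phi>" and M: "M > 0" "g [^] M \<in> N" "\<phi> (g [^] M) \<noteq> 0"
  shows "virtual_retract (range (\<lambda>k::int. g [^] k)) G"
proof -
  have sN: "subgroup N G" using N by (simp add: finite_index_def)
  note Nc = subgroup.mem_carrier[OF sN]
  note \<phi>s = integer_character_simps[OF sN \<phi>]
  have conj: "x \<otimes> n \<otimes> inv x \<in> N" if "x \<in> carrier G" "n \<in> N" for x n
    using that N(1) by (simp add: normal.inv_op_closed2)
  have conj_mult: "x \<otimes> (a \<otimes> b) \<otimes> inv x = (x \<otimes> a \<otimes> inv x) \<otimes> (x \<otimes> b \<otimes> inv x)"
    if "x \<in> carrier G" "a \<in> carrier G" "b \<in> carrier G" for x a b
    using that by (simp add: m_assoc inv_cancel)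
  have conj_conj: "x \<otimes> (y \<otimes> a \<otimes> inv y) \<otimes> inv x = (x \<otimes> y) \<otimes> a \<otimes> inv (x \<otimes> y)"
    if "x \<in> carrier G" "y \<in> carrier G" "a \<in> carrier G" for x y a
    using that by (simp add: m_assoc inv_mult_group)
  define \<psi> where "\<psi> n = (\<Sum>i<M. \<phi> (g [^] i \<otimes> n \<otimes> inv (g [^] i)))" for n
  have \<psi>: "integer_character N G \<psi>"
    unfolding integer_character_def
  proof (intro ballI)
    fix a b assume "a \<in> N" "b \<in> N"
    then show "\<psi> (a \<otimes> b) = \<psi> a + \<psi> b"
      unfolding \<psi>_def by (simp add: conj_mult g Nc \<phi>s conj sum.distrib)
  qed
  note \<psi>s = integer_character_simps[OF sN \<psi>]
  have \<psi>_conj_g: "\<psi> (g \<otimes> n \<otimes> inv g) = \<psi> n" if n: "n \<in> N" for n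
  proof -
    define f where "f i = \<phi> (g [^] i \<otimes> n \<otimes> inv (g [^] i))" for i :: nat
    have "g [^] i \<otimes> (g \<otimes> n \<otimes> inv g) \<otimes> inv (g [^] i) = g [^] Suc i \<otimes> n \<otimes> inv (g [^] Suc i)"
      for i :: nat using conj_conj[of "g [^] i" g n] g n Nc by simp
    then have "\<psi> (g \<otimes> n \<otimes> inv g) = (\<Sum>i<M. f (Suc i))"
      unfolding \<psi>_def f_def by simp
    moreover have "\<psi> n = (\<Sum>i<M. f i)" unfolding \<psi>_def f_def ..
    \<comment> \<open>This closes the cycle: conjugation by \<open>g [^] M\<close>, an element of
      \<open>N\<close>, does not affect a character of \<open>N\<close>, so shifting the summation
      index preserves the sum.\<close>
    moreover have "f M = \<phi> n"
      unfolding f_def using M(2) n sN by (simp add: \<phi>s subgroup.m_closed subgroup.m_inv_closed)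
    moreover have "f 0 = \<phi> n" unfolding f_def using n Nc by simp
    ultimately show ?thesis
      using sum.lessThan_Suc_shift[of f M] sum.lessThan_Suc[of f M] by linarith
  qed
  have \<psi>_conj_nat: "\<psi> (g [^] k \<otimes> n \<otimes> inv (g [^] k)) = \<psi> n" if n: "n \<in> N" for n and k :: nat
  proof (induction k)
    case (Suc k)
    have "g [^] Suc k \<otimes> n \<otimes> inv (g [^] Suc k) = g \<otimes> (g [^] k \<otimes> n \<otimes> inv (g [^] k)) \<otimes> inv g"
      using conj_conj[of g "g [^] k" n] nat_pow_Suc2[OF g, of k] g n Nc by simp
    with Suc n g show ?case by (simp add: \<psi>_conj_g conj del: nat_pow_Suc)
  qed (use n Nc in simp)
  have \<psi>_conj: "\<psi> (g [^] k \<otimes> n \<otimes> inv (g [^] k)) = \<psi> n" if n: "n \<in> N" for n and k :: int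
  proof (cases k)
    case (nonneg j)
    then show ?thesis using \<psi>_conj_nat[OF n] by (simp add: int_pow_int)
  next
    case (neg j)
    let ?x = "g [^] Suc j"
    have x: "?x \<in> carrier G" using g by simp
    have "g [^] k = inv ?x" unfolding neg by (rule int_pow_neg_int[OF g])
    moreover have "\<psi> (?x \<otimes> (inv ?x \<otimes> n \<otimes> inv (inv ?x)) \<otimes> inv ?x) = \<psi> (inv ?x \<otimes> n \<otimes> inv (inv ?x))"
      using x n by (intro \<psi>_conj_nat conj) auto
    moreover have "?x \<otimes> (inv ?x \<otimes> n \<otimes> inv (inv ?x)) \<otimes> inv ?x = n"
      using conj_conj[of ?x "inv ?x" n] x n Nc by (simp del: nat_pow_Suc)
    ultimately show ?thesis by simp
  qed
  let ?C = "range (\<lambda>k::int. g [^] k)" and ?N0 = "{n \<in> N. \<psi> n = 0}"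
  let ?m = "int M * \<phi> (g [^] M)"
  have gM: "\<psi> (g [^] M) = ?m"
  proof -
    have "g [^] i \<otimes> g [^] M \<otimes> inv (g [^] i) = g [^] M" for i :: nat
    proof -
      have "g [^] i \<otimes> g [^] M = g [^] M \<otimes> g [^] i" using g by (simp add: nat_pow_mult add.commute)
      then show ?thesis using g by (simp add: m_assoc)
    qed
    then show ?thesis by (simp add: \<psi>_def)
  qed
  have C: "subgroup ?C G"
  proof -
    have "?C = generate G {g}" using generate_pow[OF g] by auto
    then show ?thesis using g by (simp add: generate_is_subgroup)
  qed
  have N0: "subgroup ?N0 G"
    by (rule subgroupI)
      (use sN Nc in \<open>auto simp: \<psi>s subgroup.m_closed subgroup.m_inv_closed subgroup.one_closed
        intro!: exI[of _ \<one>]\<close>)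
  show ?thesis
  proof (rule virtual_retract_complement[OF C N0])
    show "c \<otimes> n \<otimes> inv c \<in> ?N0" if "c \<in> ?C" "n \<in> ?N0" for c n
      using that \<psi>_conj conj g by auto
    show "?N0 \<inter> ?C = {\<one>}"
    proof (intro equalityI subsetI)
      fix x assume x: "x \<in> ?N0 \<inter> ?C"
      then obtain k :: int where k: "x = g [^] k" by blast
      \<comment> \<open>\<open>x\<close> is compared with a power of \<open>g [^] M\<close>, since
        \<open>g\<close> itself need not lie in the domain \<open>N\<close> of
        \<open>\<psi>\<close>.\<close>
      have "x [^] int M = (g [^] M) [^] k"
        using g unfolding k int_pow_int[symmetric] by (simp only: int_pow_pow mult.commute)
      then have "\<psi> ((g [^] M) [^] k) = 0"
        using x \<psi>s(4)[of x "int M"] by auto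
      then have "k = 0" using \<psi>s(4)[OF M(2), of k] gM M by auto
      then show "x \<in> {\<one>}" using k by simp
    qed (use subgroup.one_closed[OF N0] subgroup.one_closed[OF C] in blast)
    \<comment> \<open>An element with value \<open>?m * j\<close> falls into the kernel of
      \<open>\<psi>\<close> after division by the \<open>j\<close>-th power of
      \<open>g [^] M\<close>, whose own value is \<open>?m\<close>.\<close>
    show "finite_index {x \<in> N. ?m dvd \<psi> x} G"
      using N(2) \<psi> M by (intro finite_index_character_dvd) auto
    show "{x \<in> N. ?m dvd \<psi> x} \<subseteq> ?N0 <#> ?C"
    proof
      fix x assume "x \<in> {x \<in> N. ?m dvd \<psi> x}"
      then obtain j where x: "x \<in> N" "\<psi> x = ?m * j" by blast
      let ?c = "(g [^] M) [^] j"
      have cN: "?c \<in> N" using M(2) sN subgroup_int_pow_closed by blast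
      have "x \<otimes> inv ?c \<in> ?N0"
        using x cN M(2) gM sN by (simp add: \<psi>s subgroup.m_closed subgroup.m_inv_closed)
      moreover have "?c \<in> ?C" using g unfolding int_pow_int[symmetric] by (simp add: int_pow_pow)
      moreover have "x = (x \<otimes> inv ?c) \<otimes> ?c" using x cN Nc by (simp add: m_assoc)
      ultimately show "x \<in> ?N0 <#> ?C" unfolding set_mult_def by blast
    qed
  qed
qed

text \<open>A generator of finite order gives a finite subgroup, settled by residual finiteness.
  Otherwise detecting one power is enough: a further power enters a normal finite index subgroup,
  and its character value is a nonzero multiple of the old one.\<close>

theorem property_VRC_criterion:
  assumes rf: "residually_finite G"
    and det: "\<And>x. x \<in> carrier G \<Longrightarrow> (\<And>n::nat. n > 0 \<Longrightarrow> x [^] n \<noteq> \<one>) \<Longrightarrow>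
      \<exists>n::nat. n > 0 \<and> virtually_detected G (x [^] n)"
  shows "property_VRC G"
  unfolding property_VRC_def
proof (intro allI impI)
  fix C assume *: "subgroup C G \<and> cyclic_group (G\<lparr>carrier := C\<rparr>)"
  then have C: "subgroup C G" by simp
  interpret C: group "G\<lparr>carrier := C\<rparr>" using C by (rule subgroup_imp_group)
  from * obtain g where g: "g \<in> C" "C = range (\<lambda>k::int. g [^]\<^bsub>G\<lparr>carrier := C\<rparr>\<^esub> k)"
    by (auto simp: C.cyclic_group)
  then have Cg: "C = range (\<lambda>k::int. g [^] k)" using int_pow_consistent[OF C] by auto
  have gc: "g \<in> carrier G" using g C by (auto dest: subgroup.mem_carrier)
  show "virtual_retract C G"
  proof (cases "\<exists>n::nat. n > 0 \<and> g [^] n = \<one>")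
    case True
    then obtain n :: nat where n: "n > 0" "g [^] n = \<one>" by blast
    have "g [^] k \<in> (\<lambda>k. g [^] k) ` {0..<int n}" for k :: int
    proof
      have "g [^] k = g [^] (int n * (k div int n) + k mod int n)" by simp
      also have "\<dots> = (g [^] n) [^] (k div int n) \<otimes> g [^] (k mod int n)"
        using gc by (simp only: int_pow_mult int_pow_pow[symmetric] int_pow_int)
      also have "\<dots> = g [^] (k mod int n)" using n gc by simp
      finally show "g [^] k = g [^] (k mod int n)" .
    qed (use n in auto)
    then have "C \<subseteq> (\<lambda>k. g [^] k) ` {0..<int n}" unfolding Cg by blast
    then have "finite C" by (rule finite_subset) auto
    with rf C show ?thesis by (rule virtual_retract_finite)
  next
    case False
    with det[OF gc] obtain n :: nat where n: "n > 0" "virtually_detected G (g [^] n)" by blast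
    then obtain K \<phi> where K: "finite_index K G" "integer_character K G \<phi>"
      "g [^] n \<in> K" "\<phi> (g [^] n) \<noteq> 0" by (auto simp: virtually_detected_def)
    have sK: "subgroup K G" using K by (simp add: finite_index_def)
    obtain N where N: "N \<lhd> G" "finite_index N G" "N \<subseteq> K" using finite_index_core[OF K(1)] .
    obtain m :: nat where m: "m > 0" "(g [^] n) [^] m \<in> N"
      using finite_index_power[OF N(2), of "g [^] n"] gc by auto
    have "g [^] (n * m) = (g [^] n) [^] m" using gc by (simp add: nat_pow_pow)
    moreover have "\<phi> ((g [^] n) [^] m) = int m * \<phi> (g [^] n)"
      using integer_character_simps(4)[OF sK K(2,3), of "int m"] by (simp add: int_pow_int)
    moreover have "integer_character N G \<phi>"
      using K(2) N(3) by (auto simp: integer_character_def)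
    ultimately show ?thesis
      unfolding Cg using gc N n m K(4)
      by (intro virtual_retract_infinite_cyclic[of g N \<phi> "n * m"]) auto
  qed
qed

end

text \<open>Finite index subgroups and characters of \<open>A\<close> pull back along
  \<open>f\<close> to \<open>H\<close>, hence to \<open>G\<close>. Squares suffice in
  \<open>det\<close>: if \<open>x\<close> has infinite order and \<open>x [^] n\<close> lies in
  \<open>H\<close>, injectivity of \<open>f\<close> keeps the square of the image
  nontrivial.\<close>

theorem property_VRC_finite_index_embedding:
  assumes G: "group G" and A: "group A" and H: "finite_index H G"
    and f: "f \<in> mon (G\<lparr>carrier := H\<rparr>) A" and rf: "residually_finite A"
    and det: "\<And>x. x \<in> carrier A \<Longrightarrow> x \<otimes>\<^bsub>A\<^esub> x \<noteq> \<one>\<^bsub>A\<^esub> \<Longrightarrow> virtually_detected A (x \<otimes>\<^bsub>A\<^esub> x)"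
  shows "property_VRC G"
proof -
  interpret G: group G by fact
  have sH: "subgroup H G" using H by (simp add: finite_index_def)
  interpret f: group_hom "G\<lparr>carrier := H\<rparr>" A f
    using G.subgroup_imp_group[OF sH] A f by (auto simp: group_hom_def group_hom_axioms_def mon_def)
  have inj: "f x = \<one>\<^bsub>A\<^esub> \<Longrightarrow> x = \<one>\<^bsub>G\<^esub>" if "x \<in> H" for x
  proof -
    have "inj_on f H" using f by (simp add: mon_def)
    moreover have "f \<one>\<^bsub>G\<^esub> = \<one>\<^bsub>A\<^esub>" using f.hom_one by simp
    ultimately show "f x = \<one>\<^bsub>A\<^esub> \<Longrightarrow> x = \<one>\<^bsub>G\<^esub>"
      using that subgroup.one_closed[OF sH] by (metis inj_onD)
  qed
  have pull: "finite_index {x \<in> H. f x \<in> K} G" if "finite_index K A" for K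
    using G.finite_index_trans[OF H] f.finite_index_vimage[OF that] by simp
  show ?thesis
  proof (rule G.property_VRC_criterion)
    show "residually_finite G"
      unfolding residually_finite_def
    proof (intro ballI impI)
      fix x assume x: "x \<in> carrier G" "x \<noteq> \<one>\<^bsub>G\<^esub>"
      show "\<exists>K. finite_index K G \<and> x \<notin> K"
      proof (cases "x \<in> H")
        case True
        then have "f x \<in> carrier A" "f x \<noteq> \<one>\<^bsub>A\<^esub>" using f.hom_closed[of x] inj x by auto
        then obtain K where "finite_index K A" "f x \<notin> K"
          using rf unfolding residually_finite_def by blast
        with pull[of K] show ?thesis by blast
      qed (use H in blast)
    qed
    fix x assume x: "x \<in> carrier G" and inf: "\<And>n::nat. n > 0 \<Longrightarrow> x [^]\<^bsub>G\<^esub> n \<noteq> \<one>\<^bsub>G\<^esub>"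
    obtain n :: nat where n: "n > 0" "x [^]\<^bsub>G\<^esub> n \<in> H"
      using G.finite_index_power[OF H x] by blast
    let ?y = "x [^]\<^bsub>G\<^esub> n"
    have yy: "?y \<otimes>\<^bsub>G\<^esub> ?y = x [^]\<^bsub>G\<^esub> (n + n)" using x by (simp add: G.nat_pow_mult)
    have yyH: "?y \<otimes>\<^bsub>G\<^esub> ?y \<in> H" using n sH by (simp add: subgroup.m_closed)
    have fy: "f (?y \<otimes>\<^bsub>G\<^esub> ?y) = f ?y \<otimes>\<^bsub>A\<^esub> f ?y" using n f.hom_mult[of ?y ?y] by simp
    have "f ?y \<otimes>\<^bsub>A\<^esub> f ?y \<noteq> \<one>\<^bsub>A\<^esub>"
      using inj[OF yyH] inf[of "n + n"] n(1) unfolding fy[symmetric] yy by blast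
    moreover have "f ?y \<in> carrier A" using n(2) f.hom_closed[of ?y] by simp
    ultimately have "virtually_detected A (f (?y \<otimes>\<^bsub>G\<^esub> ?y))" using det fy by simp
    then obtain K \<phi> where K: "finite_index K A" "integer_character K A \<phi>"
        "f (?y \<otimes>\<^bsub>G\<^esub> ?y) \<in> K" "\<phi> (f (?y \<otimes>\<^bsub>G\<^esub> ?y)) \<noteq> 0"
      unfolding virtually_detected_def by blast
    have "integer_character {x \<in> H. f x \<in> K} G (\<lambda>x. \<phi> (f x))"
      using K(2) f.hom_mult by (auto simp: integer_character_def)
    with K pull[OF K(1)] yyH have "virtually_detected G (x [^]\<^bsub>G\<^esub> (n + n))"
      unfolding virtually_detected_def yy[symmetric] by blast
    then show "\<exists>n::nat. n > 0 \<and> virtually_detected G (x [^]\<^bsub>G\<^esub> n)"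
      using n by (intro exI[of _ "n + n"]) auto
  qed
qed

section \<open>Words in right-angled Coxeter groups\<close>

definition cox_action :: "('u \<times> 'u) set \<Rightarrow> ('u \<Rightarrow> 'c \<Rightarrow> 'c) \<Rightarrow> bool" where
  "cox_action E g \<longleftrightarrow>
     (\<forall>s y. g s (g s y) = y) \<and> (\<forall>s t y. (s, t) \<in> E \<longrightarrow> g s (g t y) = g t (g s y))"

text \<open>A finite index subgroup with an integer character is encoded by an action on
  \<open>bool list \<times> int\<close> commuting with the translations of \<open>int\<close> and preserving the length of the list:
  the subgroup stabilises the fibre over a list, and acts on that fibre by translations.\<close>

definition shift :: "int \<Rightarrow> bool list \<times> int \<Rightarrow> bool list \<times> int" where
  "shift m y = (fst y, snd y + m)"

definition equivariant :: "(bool list \<times> int \<Rightarrow> bool list \<times> int) \<Rightarrow> bool" where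
  "equivariant f \<longleftrightarrow>
     (\<forall>y. length (fst (f y)) = length (fst y)) \<and> (\<forall>m y. f (shift m y) = shift m (f y))"

definition lattice_action ::
  "('u \<times> 'u) set \<Rightarrow> ('u \<Rightarrow> bool list \<times> int \<Rightarrow> bool list \<times> int) \<Rightarrow> bool" where
  "lattice_action E p \<longleftrightarrow> cox_action E p \<and> (\<forall>s. equivariant (p s))"

lemma cox_actionD:
  assumes "cox_action E g"
  shows "g s (g s y) = y" "(s, t) \<in> E \<Longrightarrow> g s (g t y) = g t (g s y)"
  using assms unfolding cox_action_def by blast+

lemma equivariant_foldr:
  assumes "\<And>s. s \<in> set w \<Longrightarrow> equivariant (p s)"
  shows "equivariant (foldr p w)"
  using assms
proof (induction w)
  case (Cons s w)
  then have "equivariant (p s)" "equivariant (foldr p w)" by simp_all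
  then show ?case by (simp add: equivariant_def del: split_paired_All)
qed (simp add: equivariant_def)

section \<open>Parity counts and infinite dihedral actions\<close>

definition typewise_even :: "('v \<times> 'l) list \<Rightarrow> bool" where
  "typewise_even w \<longleftrightarrow> (\<forall>\<tau>. even (length (filter (\<lambda>s. fst s = \<tau>) w)))"

text \<open>The infinite dihedral group on its Cayley line: a point is the head bit together with
  the integer, and the edges are alternately labelled \<open>v\<close> and \<open>v'\<close>. The
  tail of the list is inert, and empty lists are fixed.\<close>

definition dihedral_action :: "'u \<Rightarrow> 'u \<Rightarrow> 'u \<Rightarrow> bool list \<times> int \<Rightarrow> bool list \<times> int" where
  "dihedral_action v v' s y =
     (case y of ([], n) \<Rightarrow> y
      | (b # x, n) \<Rightarrow>
          if s = v then ((\<not> b) # x, n)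
          else if s = v' then ((\<not> b) # x, n + (if b then 1 else - 1))
          else y)"

lemma bool_list_int_cases:
  fixes y :: "bool list \<times> int"
  obtains n where "y = ([], n)" | b x n where "y = (b # x, n)"
  by (metis list.exhaust surj_pair)

lemma dihedral_action_simps [simp]:
  "dihedral_action v v' s ([], n) = ([], n)"
  "dihedral_action v v' s (b # x, n) =
     (if s = v then ((\<not> b) # x, n)
      else if s = v' then ((\<not> b) # x, n + (if b then 1 else - 1))
      else (b # x, n))"
  by (simp_all add: dihedral_action_def)

text \<open>All other generators act trivially, so only \<open>v\<close> and \<open>v'\<close> could
  violate a commutation relation, and they are not adjacent.\<close>

lemma lattice_action_dihedral:
  assumes "(v, v') \<notin> E" "(v', v) \<notin> E"
  shows "lattice_action E (dihedral_action v v')"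
proof -
  have "dihedral_action v v' s (dihedral_action v v' s y) = y" for s y
    by (cases y rule: bool_list_int_cases) auto
  moreover have "dihedral_action v v' s (dihedral_action v v' t y) =
      dihedral_action v v' t (dihedral_action v v' s y)" if "(s, t) \<in> E" for s t y
    using assms that by (cases y rule: bool_list_int_cases) auto
  moreover have "length (fst (dihedral_action v v' s y)) = length (fst y)" for s y
    by (cases y rule: bool_list_int_cases) auto
  moreover have "dihedral_action v v' s (shift m y) = shift m (dihedral_action v v' s y)" for s m y
    by (cases y rule: bool_list_int_cases) (auto simp: shift_def)
  ultimately show ?thesis
    unfolding lattice_action_def cox_action_def equivariant_def by blast
qed

text \<open>Both involutions flip the bit, but only \<open>v'\<close> changes the integer, by one
  each time. Hence the displacement has a known parity, and an odd displacement is nonzero.\<close>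

lemma foldr_dihedral_action:
  assumes "v \<noteq> v'"
  shows "\<exists>m. foldr (dihedral_action v v') w (b # x, n) =
           ((b = even (count_list w v + count_list w v')) # x, m)
         \<and> (even (m - n) \<longleftrightarrow> even (count_list w v'))"
proof (induction w)
  case (Cons s w)
  then obtain m where "foldr (dihedral_action v v') w (b # x, n) =
           ((b = even (count_list w v + count_list w v')) # x, m)"
         "even (m - n) \<longleftrightarrow> even (count_list w v')" by blast
  with assms show ?case by auto
qed auto

lemma length_filter_eq_sum_count_list:
  assumes "finite S" "\<And>s. s \<in> set w \<Longrightarrow> P s \<longleftrightarrow> s \<in> S"
  shows "length (filter P w) = (\<Sum>s\<in>S. count_list w s)"
  using assms(2)
proof (induction w)
  case (Cons a w)
  have "(\<Sum>s\<in>S. count_list (a # w) s) = (\<Sum>s\<in>S. count_list w s) + (\<Sum>s\<in>S. if a = s then 1 else 0)"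
    by (subst sum.distrib[symmetric]) (intro sum.cong, auto)
  with Cons assms(1) show ?case by auto
qed auto

text \<open>The even count of a type is the sum of the counts of its generators, so it cannot have
  exactly one odd summand.\<close>

lemma odd_partner:
  assumes "typewise_even w" "odd (count_list w v)"
  obtains v' where "v' \<noteq> v" "fst v' = fst v" "odd (count_list w v')"
proof -
  let ?S = "{s \<in> set w. fst s = fst v}"
  have v: "v \<in> ?S"
    using assms(2) count_list_0_iff[of w v] by (auto intro: ccontr)
  have "length (filter (\<lambda>s. fst s = fst v) w) = (\<Sum>s\<in>?S. count_list w s)"
    by (rule length_filter_eq_sum_count_list) auto
  moreover have "(\<Sum>s\<in>?S. count_list w s) = count_list w v + (\<Sum>s\<in>?S - {v}. count_list w s)"
    by (rule sum.remove[OF _ v]) auto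
  moreover have "even (length (filter (\<lambda>s. fst s = fst v) w))"
    using assms(1) by (simp add: typewise_even_def)
  ultimately have "odd (\<Sum>s\<in>?S - {v}. count_list w s)" using assms(2) by simp
  then have "\<exists>s\<in>?S - {v}. odd (count_list w s)" by (blast intro: dvd_sum)
  then show ?thesis using that by auto
qed

section \<open>The kernel of the map onto one generator, and induced actions\<close>

text \<open>The generators of the kernel of the map onto \<open>\<langle>v\<rangle>\<close> are the conjugates of the
  \<open>s \<noteq> v\<close> by \<open>1\<close> and by \<open>v\<close>; the new head of the list tells them apart. They coincide when \<open>s\<close> and
  \<open>v\<close> commute, so then only the copy \<open>False\<close> is used. The type of a vertex is its first component.\<close>

definition copy :: "('v \<times> bool list) \<Rightarrow> (('v \<times> bool list) \<times> ('v \<times> bool list)) set \<Rightarrow> bool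
    \<Rightarrow> 'v \<times> bool list \<Rightarrow> 'v \<times> bool list" where
  "copy v E b s = (fst s, (b \<and> (s, v) \<notin> E) # snd s)"

text \<open>Edges join copies for the same coset. A neighbour of \<open>v\<close> has a single copy,
  which therefore becomes adjacent to both copies of its other neighbours.\<close>

definition doubled :: "('v \<times> bool list) \<Rightarrow> (('v \<times> bool list) \<times> ('v \<times> bool list)) set
    \<Rightarrow> (('v \<times> bool list) \<times> ('v \<times> bool list)) set" where
  "doubled v E = {(copy v E b s, copy v E b t) | b s t. (s, t) \<in> E \<and> s \<noteq> v \<and> t \<noteq> v}"

text \<open>All letters \<open>v\<close> are moved to the left end and dropped. A letter crossed by
  an odd number of them, namely those on its right, is conjugated by \<open>v\<close>.\<close>

fun rewrite_word :: "('v \<times> bool list) \<Rightarrow> (('v \<times> bool list) \<times> ('v \<times> bool list)) set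
    \<Rightarrow> ('v \<times> bool list) list \<Rightarrow> ('v \<times> bool list) list" where
  "rewrite_word v E [] = []"
| "rewrite_word v E (s # w) =
     (if s = v then rewrite_word v E w
      else copy v E (odd (count_list w v)) s # rewrite_word v E w)"

text \<open>The head bit \<open>True\<close> stands for conjugation by \<open>v\<close>. A vertex
  with empty list is no copy; letting it act trivially keeps every vertex an involution.\<close>

fun kernel_action :: "('v \<times> bool list) \<Rightarrow> ('v \<times> bool list \<Rightarrow> 'c \<Rightarrow> 'c) \<Rightarrow> 'v \<times> bool list \<Rightarrow> 'c \<Rightarrow> 'c" where
  "kernel_action v g (\<tau>, []) y = y"
| "kernel_action v g (\<tau>, b # l) y = (if b then g v (g (\<tau>, l) (g v y)) else g (\<tau>, l) y)"

text \<open>The action induced from the index 2 kernel: the new head bit names a coset,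
  \<open>v\<close> exchanges the two cosets, and any other \<open>s\<close> acts over the coset
  \<open>b\<close> through its conjugate \<open>copy v E b s\<close>.\<close>

definition induced_action :: "('v \<times> bool list) \<Rightarrow> (('v \<times> bool list) \<times> ('v \<times> bool list)) set
    \<Rightarrow> ('v \<times> bool list \<Rightarrow> bool list \<times> int \<Rightarrow> bool list \<times> int)
    \<Rightarrow> 'v \<times> bool list \<Rightarrow> bool list \<times> int \<Rightarrow> bool list \<times> int" where
  "induced_action v E p s y =
     (case y of ([], n) \<Rightarrow> y
      | (b # x, n) \<Rightarrow>
          if s = v then ((\<not> b) # x, n)
          else (b # fst (p (copy v E b s) (x, n)), snd (p (copy v E b s) (x, n))))"

lemma induced_action_simps [simp]:
  "induced_action v E p s ([], n) = ([], n)"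
  "induced_action v E p s (b # x, n) =
     (if s = v then ((\<not> b) # x, n)
      else (b # fst (p (copy v E b s) (x, n)), snd (p (copy v E b s) (x, n))))"
  by (simp_all add: induced_action_def)

lemma fst_copy [simp]: "fst (copy v E b s) = fst s"
  by (simp add: copy_def)

lemma doubled_sym: "sym E \<Longrightarrow> sym (doubled v E)"
  unfolding doubled_def by (rule symI) (blast dest: symD)

lemma kernel_action_copy:
  assumes "cox_action E g"
  shows "kernel_action v g (copy v E b s) y = (if b then g v (g s (g v y)) else g s y)"
proof (cases "b \<and> (s, v) \<in> E")
  case True
  then show ?thesis
    using cox_actionD(1)[OF assms, of v] cox_actionD(2)[OF assms, of s v "y"] by (simp add: copy_def)
qed (auto simp: copy_def)

lemma cox_action_kernel:
  assumes g: "cox_action E g"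
  shows "cox_action (doubled v E) (kernel_action v g)"
proof -
  note G = cox_actionD[OF g]
  have "kernel_action v g s (kernel_action v g s y) = y" for s y
    by (cases "(v, g, s, y)" rule: kernel_action.cases) (auto simp: G)
  moreover have "kernel_action v g s (kernel_action v g t y) = kernel_action v g t (kernel_action v g s y)"
    if "(s, t) \<in> doubled v E" for s t y
  proof -
    obtain b s' t' where st: "s = copy v E b s'" "t = copy v E b t'" "(s', t') \<in> E"
      using \<open>(s, t) \<in> doubled v E\<close> by (auto simp: doubled_def)
    show ?thesis
      unfolding st(1,2) kernel_action_copy[OF g] by (simp add: G(1) G(2)[OF st(3)])
  qed
  ultimately show ?thesis unfolding cox_action_def by blast
qed

lemma foldr_rewrite_word:
  assumes "cox_action E g"
  shows "foldr g w y =
    (if odd (count_list w v) then g v else id) (foldr (kernel_action v g) (rewrite_word v E w) y)"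
  by (induction w) (auto simp: kernel_action_copy[OF assms] cox_actionD(1)[OF assms])

lemma lattice_action_induced:
  assumes "lattice_action (doubled v E) p" "sym E" "(v, v) \<notin> E"
  shows "lattice_action E (induced_action v E p)"
proof -
  have p: "cox_action (doubled v E) p" and eq: "equivariant (p s)" for s
    using assms unfolding lattice_action_def by blast+
  note P = cox_actionD[OF p]
  have "equivariant (induced_action v E p s)" for s
    unfolding equivariant_def
  proof (intro conjI allI)
    fix m y
    show "length (fst (induced_action v E p s y)) = length (fst y)"
      by (cases y rule: bool_list_int_cases) (use eq in \<open>auto simp: equivariant_def\<close>)
    have "p t (x, n + m) = shift m (p t (x, n))" for t x n
      using eq[of t] unfolding equivariant_def shift_def by (metis fst_conv snd_conv)
    then show "induced_action v E p s (shift m y) = shift m (induced_action v E p s y)"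
      by (cases y rule: bool_list_int_cases) (auto simp: shift_def)
  qed
  moreover have "induced_action v E p s (induced_action v E p s y) = y" for s y
    by (cases y rule: bool_list_int_cases) (auto simp: P(1))
  moreover have "induced_action v E p s (induced_action v E p t y) =
      induced_action v E p t (induced_action v E p s y)" if "(s, t) \<in> E" for s t y
  proof (cases "s = v \<or> t = v")
    case True
    \<comment> \<open>A neighbour of \<open>v\<close> acts through the same copy over both cosets,
      hence commutes with their exchange.\<close>
    moreover have "(s, v) \<in> E \<Longrightarrow> copy v E (\<not> b) s = copy v E b s"
        "(t, v) \<in> E \<Longrightarrow> copy v E (\<not> b) t = copy v E b t" for b
      by (simp_all add: copy_def)
    moreover have "(t, s) \<in> E" using that assms(2) by (auto dest: symD)
    ultimately show ?thesis
      using that assms(3) by (cases y rule: bool_list_int_cases) auto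
  next
    case False
    then have "(copy v E b s, copy v E b t) \<in> doubled v E" for b
      using that unfolding doubled_def by blast
    from P(2)[OF this] show ?thesis
      using False by (cases y rule: bool_list_int_cases) auto
  qed
  ultimately show ?thesis unfolding lattice_action_def cox_action_def by blast
qed

text \<open>Starting from \<open>False\<close>, the head bit met by a letter is the parity of the
  \<open>v\<close> to its right, exactly the bit used by \<open>rewrite_word\<close>. So a
  translation found for the rewritten word is one for \<open>w\<close> when \<open>v\<close> occurs
  evenly.\<close>

lemma foldr_induced_action:
  "foldr (induced_action v E p) w (False # x, n) =
     (odd (count_list w v) # fst (foldr p (rewrite_word v E w) (x, n)),
      snd (foldr p (rewrite_word v E w) (x, n)))"
  by (induction w) (auto simp: induced_action_def)

lemma length_rewrite_word: "length (rewrite_word v E w) + count_list w v = length w"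
  by (induction w) auto

lemma length_filter_rewrite_word:
  "length (filter (\<lambda>s. fst s = \<tau>) (rewrite_word v E w)) + (if fst v = \<tau> then count_list w v else 0)
   = length (filter (\<lambda>s. fst s = \<tau>) w)"
  by (induction w) auto

lemma typewise_even_rewrite_word:
  assumes "typewise_even w" "even (count_list w v)"
  shows "typewise_even (rewrite_word v E w)"
  unfolding typewise_even_def
proof
  fix \<tau>
  have "even (length (filter (\<lambda>s. fst s = \<tau>) w))"
    using assms(1) by (simp add: typewise_even_def)
  moreover have "even (if fst v = \<tau> then count_list w v else 0)"
    using assms(2) by simp
  ultimately show "even (length (filter (\<lambda>s. fst s = \<tau>) (rewrite_word v E w)))"
    unfolding length_filter_rewrite_word[of \<tau> v E w, symmetric] by (simp only: even_add)
qed

text \<open>Triviality of \<open>w\<close> is expressed through all actions on the type \<open>'c\<close>; this makes it unnecessary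
  to define the Coxeter group itself.\<close>

theorem trivial_or_translation:
  fixes E :: "(('v \<times> bool list) \<times> ('v \<times> bool list)) set"
  assumes "sym E" "\<And>s t. (s, t) \<in> E \<Longrightarrow> fst s \<noteq> fst t" "typewise_even w"
    and "\<And>p x n. lattice_action E p \<Longrightarrow> foldr p w (x, 0) = (x, n) \<Longrightarrow> n = 0"
    and "cox_action E (g :: _ \<Rightarrow> 'c \<Rightarrow> 'c)"
  shows "foldr g w y = y"
  using assms
proof (induction "length w" arbitrary: w E g rule: less_induct)
  case less
  show ?case
  proof (cases "\<exists>v. odd (count_list w v)")
    case True
    then obtain v where v: "odd (count_list w v)" by blast
    then obtain v' where v': "v' \<noteq> v" "fst v' = fst v" "odd (count_list w v')"
      using odd_partner less.prems(3) by metis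
    \<comment> \<open>Since \<open>v\<close> and \<open>v'\<close> have equal type they are not
      adjacent, so the dihedral action is available; it moves by an odd \<open>m\<close>, against
      the assumption that all translations vanish.\<close>
    obtain m where m: "foldr (dihedral_action v v') w ([False], 0) = ([False], m)"
        "even m \<longleftrightarrow> even (count_list w v')"
      using foldr_dihedral_action[of v v' w False "[]" 0] v v' by auto
    have "lattice_action E (dihedral_action v v')"
      using less.prems(2) v'(2) by (intro lattice_action_dihedral) fastforce+
    from less.prems(4)[OF this m(1)] m(2) v'(3) show ?thesis by simp
  next
    case False
    show ?thesis
    proof (cases w)
      case (Cons v w1)
      \<comment> \<open>With all counts even, \<open>w\<close> lies in the kernel for its first
        letter \<open>v\<close>. Rewriting removes that letter, and the induction continues with the
        graph and action of the kernel.\<close>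
      let ?w = "rewrite_word v E w"
      have even: "even (count_list w v)" using False by blast
      have "foldr (kernel_action v g) ?w y = y"
      proof (rule less.hyps[where E = "doubled v E"])
        show "length ?w < length w"
          using length_rewrite_word[of v E w] Cons by simp
        show "sym (doubled v E)" using less.prems(1) by (rule doubled_sym)
        show "fst s \<noteq> fst t" if "(s, t) \<in> doubled v E" for s t
          using that less.prems(2) by (auto simp: doubled_def)
        show "typewise_even ?w" using less.prems(3) even by (rule typewise_even_rewrite_word)
        show "cox_action (doubled v E) (kernel_action v g)"
          using less.prems(5) by (rule cox_action_kernel)
        fix p x n assume p: "lattice_action (doubled v E) p" "foldr p ?w (x, 0) = (x, n)"
        have "(v, v) \<notin> E" using less.prems(2) by blast
        from less.prems(4)[OF lattice_action_induced[OF p(1) less.prems(1) this], of "False # x" n]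
        show "n = 0" using p(2) even by (simp add: foldr_induced_action)
      qed
      then show ?thesis using foldr_rewrite_word[OF less.prems(5), of w y v] even by simp
    qed simp
  qed
qed

section \<open>Maps out of graph products\<close>

lemma BijGroup_UNIV:
  "f \<in> carrier (BijGroup (UNIV :: 'c set)) \<longleftrightarrow> bij f"
  "bij f \<Longrightarrow> bij g \<Longrightarrow> f \<otimes>\<^bsub>BijGroup (UNIV :: 'c set)\<^esub> g = f \<circ> g"
  "\<one>\<^bsub>BijGroup (UNIV :: 'c set)\<^esub> = id"
  by (auto simp: BijGroup_def Bij_def compose_def)

locale graph_of_groups =
  fixes V :: "'v set" and E :: "('v \<times> 'v) set" and F :: "'v \<Rightarrow> 'b monoid"
  assumes graph: "simplicial_graph V E"
    and group_vertex: "\<And>v. v \<in> V \<Longrightarrow> group (F v)"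
begin

abbreviation "FP \<equiv> free_product V F"
abbreviation "NC \<equiv> normal_closure FP (graph_relators V E F)"
abbreviation "A \<equiv> graph_product V E F"
abbreviation "cls w \<equiv> free_rel V F `` {w}"

definition word :: "('v \<times> 'b) list \<Rightarrow> ('v \<times> 'b) list set set" where
  "word w = NC #>\<^bsub>FP\<^esub> cls w"

sublocale FP: group FP
  by (rule group_free_product) (rule group_vertex)

sublocale A: group A
  using graph group_vertex by (rule group_graph_product)

lemmas fp_mult = free_product_mult[where V = V and F = F, OF group_vertex]
lemmas fp_equiv = equiv_free_rel[where V = V and F = F, OF group_vertex]

lemma edgeD: "(u, v) \<in> E \<Longrightarrow> u \<in> V \<and> v \<in> V \<and> u \<noteq> v"
  using graph by (auto simp: simplicial_graph_def irrefl_def)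

lemma sym_E: "sym E"
  using graph by (simp add: simplicial_graph_def)

lemma cls_closed: "w \<in> free_words V F \<Longrightarrow> cls w \<in> carrier FP"
  by (simp add: free_product_def quotientI)

lemma cls_eqI: "(x, y) \<in> free_rel V F \<Longrightarrow> cls x = cls y"
  by (rule equiv_class_eq[OF fp_equiv])

lemma relators_closed: "graph_relators V E F \<subseteq> carrier FP"
  using edgeD cls_closed by (fastforce simp: graph_relators_def commutator_def free_incl_def)

sublocale NC: normal NC FP
  using relators_closed by (rule FP.normal_closure_normal)

lemma word_append:
  assumes "x \<in> free_words V F" "y \<in> free_words V F"
  shows "word x \<otimes>\<^bsub>A\<^esub> word y = word (x @ y)"
  using assms NC.rcos_sum[OF cls_closed cls_closed, of x y]
  by (simp add: graph_product_def FactGroup_def word_def fp_mult)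

lemma carrier_graph_product: "carrier A = word ` free_words V F"
proof -
  have "carrier FP = cls ` free_words V F"
    by (auto simp: free_product_def quotient_def)
  then show ?thesis
    unfolding graph_product_def carrier_FactGroup word_def by auto
qed

lemma word_closed: "w \<in> free_words V F \<Longrightarrow> word w \<in> carrier A"
  by (simp add: carrier_graph_product)

lemma word_Nil: "word [] = \<one>\<^bsub>A\<^esub>"
proof -
  have "cls [] = \<one>\<^bsub>FP\<^esub>" by (simp add: free_product_def)
  then show ?thesis
    by (simp add: word_def graph_product_def FactGroup_def NC.subset)
qed

lemma word_one: "v \<in> V \<Longrightarrow> word [(v, \<one>\<^bsub>F v\<^esub>)] = \<one>\<^bsub>A\<^esub>"
  using cls_eqI[OF free_rel.one[of "[]" V F "[]" v]] by (simp add: word_def flip: word_Nil)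

lemma word_mult:
  assumes "v \<in> V" "a \<in> carrier (F v)" "b \<in> carrier (F v)"
  shows "word [(v, a)] \<otimes>\<^bsub>A\<^esub> word [(v, b)] = word [(v, a \<otimes>\<^bsub>F v\<^esub> b)]"
  using assms cls_eqI[OF free_rel.mult[of "[]" V F "[]" v a b]]
  by (simp add: word_append) (simp add: word_def)

lemma word_commute:
  assumes "(u, v) \<in> E" "a \<in> carrier (F u)" "b \<in> carrier (F v)"
  shows "word [(u, a)] \<otimes>\<^bsub>A\<^esub> word [(v, b)] = word [(v, b)] \<otimes>\<^bsub>A\<^esub> word [(u, a)]"
proof -
  have w: "[(u, a)] \<in> free_words V F" "[(v, b)] \<in> free_words V F" using assms edgeD by auto
  let ?x = "cls [(u, a)]" and ?y = "cls [(v, b)]"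
  have xy: "?x \<in> carrier FP" "?y \<in> carrier FP" using w by (auto intro: cls_closed)
  let ?c = "commutator FP ?x ?y"
  have c: "?c \<in> graph_relators V E F"
    using assms by (auto simp: graph_relators_def free_incl_def)
  then have cFP: "?c \<in> carrier FP" using relators_closed by blast
  have "\<one>\<^bsub>FP\<^esub> \<otimes>\<^bsub>FP\<^esub> ?c \<otimes>\<^bsub>FP\<^esub> inv\<^bsub>FP\<^esub> \<one>\<^bsub>FP\<^esub> \<in> NC"
    unfolding normal_closure_def using c by (intro generate.incl) blast
  then have "?c \<in> NC" using cFP by simp
  moreover have "?c = (?x \<otimes>\<^bsub>FP\<^esub> ?y) \<otimes>\<^bsub>FP\<^esub> inv\<^bsub>FP\<^esub> (?y \<otimes>\<^bsub>FP\<^esub> ?x)"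
    using xy by (simp add: commutator_def FP.inv_mult_group FP.m_assoc)
  ultimately have "NC #>\<^bsub>FP\<^esub> ((?x \<otimes>\<^bsub>FP\<^esub> ?y) \<otimes>\<^bsub>FP\<^esub> inv\<^bsub>FP\<^esub> (?y \<otimes>\<^bsub>FP\<^esub> ?x)) = NC"
    using cFP NC.subgroup_axioms by (intro FP.coset_join2) auto
  then have "NC #>\<^bsub>FP\<^esub> (?x \<otimes>\<^bsub>FP\<^esub> ?y) = NC #>\<^bsub>FP\<^esub> (?y \<otimes>\<^bsub>FP\<^esub> ?x)"
    using xy NC.subset by (intro FP.coset_mult_inv1) auto
  then show ?thesis using w by (simp add: word_append) (simp add: word_def fp_mult)
qed

text \<open>The universal property of the graph product, with the permutations of \<open>'c\<close>
  as target: the induced homomorphism on the free product kills the commutators of adjacent letters,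
  hence their normal closure.\<close>

theorem foldr_word_cong:
  fixes f :: "'v \<times> 'b \<Rightarrow> 'c \<Rightarrow> 'c"
  assumes one: "\<And>v y. v \<in> V \<Longrightarrow> f (v, \<one>\<^bsub>F v\<^esub>) y = y"
    and mult: "\<And>v a b y. v \<in> V \<Longrightarrow> a \<in> carrier (F v) \<Longrightarrow> b \<in> carrier (F v) \<Longrightarrow>
      f (v, a \<otimes>\<^bsub>F v\<^esub> b) y = f (v, a) (f (v, b) y)"
    and comm: "\<And>u v a b y. (u, v) \<in> E \<Longrightarrow> a \<in> carrier (F u) \<Longrightarrow> b \<in> carrier (F v) \<Longrightarrow>
      f (u, a) (f (v, b) y) = f (v, b) (f (u, a) y)"
    and w: "w \<in> free_words V F" "w' \<in> free_words V F" "word w = word w'"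
  shows "foldr f w = foldr f w'"
proof -
  let ?B = "BijGroup (UNIV :: 'c set)"
  interpret B: group ?B by (rule group_BijGroup)
  have bij_letter: "bij (f (v, a))" if "v \<in> V" "a \<in> carrier (F v)" for v a
  proof -
    interpret Fv: group "F v" using group_vertex that(1) .
    have "f (v, a) (f (v, inv\<^bsub>F v\<^esub> a) y) = y" "f (v, inv\<^bsub>F v\<^esub> a) (f (v, a) y) = y" for y
      using mult[of v a "inv\<^bsub>F v\<^esub> a" y] mult[of v "inv\<^bsub>F v\<^esub> a" a y] one that by simp_all
    then show ?thesis by (intro o_bij[of "f (v, inv\<^bsub>F v\<^esub> a)"]) auto
  qed
  have bij: "bij (foldr f x)" if "x \<in> free_words V F" for x
    using that
  proof (induction x)
    case (Cons p x)
    then have "bij (f p)" using bij_letter[of "fst p" "snd p"] by simp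
    with Cons show ?case using bij_comp[of "foldr f x" "f p"] by (simp add: comp_def)
  qed simp
  have rel: "foldr f x = foldr f x'" if "(x, x') \<in> free_rel V F" for x x'
    using that by induction (auto simp: fun_eq_iff one mult)
  \<comment> \<open>The chosen representative does not matter, because \<open>foldr f\<close> is
    constant on classes by \<open>rel\<close>.\<close>
  define \<psi> where "\<psi> X = foldr f (SOME x. x \<in> X)" for X
  have \<psi>: "\<psi> (cls x) = foldr f x" if "x \<in> free_words V F" for x
  proof -
    have "(x, x) \<in> free_rel V F" using that by (rule free_rel.refl)
    then have "(SOME x'. x' \<in> cls x) \<in> cls x" by (intro someI[of "\<lambda>x'. x' \<in> cls x" x]) simp
    then show ?thesis unfolding \<psi>_def using rel by (metis Image_singleton_iff)
  qed
  have FP_cls: "\<exists>x\<in>free_words V F. X = cls x" if "X \<in> carrier FP" for X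
    using that by (auto simp: free_product_def quotient_def)
  have "\<psi> \<in> hom FP ?B"
  proof (rule homI)
    fix X assume "X \<in> carrier FP"
    then show "\<psi> X \<in> carrier ?B" using FP_cls \<psi> bij by (fastforce simp: BijGroup_UNIV)
  next
    fix X Y assume "X \<in> carrier FP" "Y \<in> carrier FP"
    then obtain x y where xy: "x \<in> free_words V F" "y \<in> free_words V F" "X = cls x" "Y = cls y"
      using FP_cls by metis
    then show "\<psi> (X \<otimes>\<^bsub>FP\<^esub> Y) = \<psi> X \<otimes>\<^bsub>?B\<^esub> \<psi> Y"
      by (simp add: fp_mult \<psi> bij BijGroup_UNIV foldr_append fun_eq_iff)
  qed
  then interpret \<psi>: group_hom FP ?B \<psi>
    by (simp add: group_hom_def group_hom_axioms_def FP.group_axioms B.group_axioms)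
  have kernel: "normal (kernel FP ?B \<psi>) FP" by (rule \<psi>.normal_kernel)
  have rel_kernel: "s \<in> kernel FP ?B \<psi>" if "s \<in> graph_relators V E F" for s
  proof -
    obtain u v a b where s: "s = commutator FP (cls [(u, a)]) (cls [(v, b)])"
      "(u, v) \<in> E" "a \<in> carrier (F u)" "b \<in> carrier (F v)"
      using \<open>s \<in> graph_relators V E F\<close> by (auto simp: graph_relators_def free_incl_def)
    have w: "[(u, a)] \<in> free_words V F" "[(v, b)] \<in> free_words V F" using s edgeD by auto
    let ?x = "cls [(u, a)]" and ?y = "cls [(v, b)]"
    have xy: "?x \<in> carrier FP" "?y \<in> carrier FP" using w by (auto intro: cls_closed)
    have "cls [(u, a), (v, b)] = ?x \<otimes>\<^bsub>FP\<^esub> ?y" "cls [(v, b), (u, a)] = ?y \<otimes>\<^bsub>FP\<^esub> ?x"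
      using w by (simp_all add: fp_mult)
    moreover have "\<psi> (cls [(u, a), (v, b)]) = \<psi> (cls [(v, b), (u, a)])"
      using w comm[OF s(2-4)] by (simp add: \<psi> fun_eq_iff)
    ultimately have *: "\<psi> ?x \<otimes>\<^bsub>?B\<^esub> \<psi> ?y = \<psi> ?y \<otimes>\<^bsub>?B\<^esub> \<psi> ?x" using xy by simp
    have "\<psi> s = (\<psi> ?x \<otimes>\<^bsub>?B\<^esub> \<psi> ?y) \<otimes>\<^bsub>?B\<^esub> inv\<^bsub>?B\<^esub> \<psi> ?x \<otimes>\<^bsub>?B\<^esub> inv\<^bsub>?B\<^esub> \<psi> ?y"
      using xy by (simp add: s(1) commutator_def)
    also have "\<dots> = \<one>\<^bsub>?B\<^esub>"
      unfolding * using \<psi>.hom_closed[OF xy(1)] \<psi>.hom_closed[OF xy(2)] by (simp add: B.m_assoc B.inv_cancel)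
    finally show ?thesis using relators_closed that by (auto simp: kernel_def)
  qed
  have "NC \<subseteq> kernel FP ?B \<psi>"
    unfolding normal_closure_def
    using rel_kernel normal.inv_op_closed2[OF kernel]
    by (intro FP.generate_subgroup_incl[OF _ \<psi>.subgroup_kernel]) auto
  moreover have "cls w \<in> NC #>\<^bsub>FP\<^esub> cls w'"
    using w FP.rcos_self[OF cls_closed[OF w(1)] NC.subgroup_axioms] by (simp add: word_def)
  then obtain n where n: "n \<in> NC" "cls w = n \<otimes>\<^bsub>FP\<^esub> cls w'" by (auto simp: r_coset_def)
  ultimately have "\<psi> n = \<one>\<^bsub>?B\<^esub>" "n \<in> carrier FP" by (auto simp: kernel_def)
  then have "\<psi> (cls w) = \<psi> (cls w')"
    using n(2) cls_closed[OF w(2)] \<psi>.hom_closed[OF cls_closed[OF w(2)]] by simp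
  then show ?thesis using w by (simp add: \<psi>)
qed

end

section \<open>Graph products covered by Coxeter groups\<close>

text \<open>Commuting with translations, the action permutes the fibres over lists, and preservation
  of length makes the orbit of \<open>l\<close> finite. Elements fixing \<open>l\<close> shift its
  fibre by constants, which add up under composition.\<close>

lemma (in group) stabilizer_character:
  assumes mult: "\<And>a b y. a \<in> carrier G \<Longrightarrow> b \<in> carrier G \<Longrightarrow> \<alpha> (a \<otimes> b) y = \<alpha> a (\<alpha> b y)"
    and one: "\<And>y. \<alpha> \<one> y = y"
    and equi: "\<And>a. a \<in> carrier G \<Longrightarrow> equivariant (\<alpha> a)"
  shows "finite_index {a \<in> carrier G. fst (\<alpha> a (l, 0)) = l} G"
    and "integer_character {a \<in> carrier G. fst (\<alpha> a (l, 0)) = l} G (\<lambda>a. snd (\<alpha> a (l, 0)))"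
proof -
  let ?S = "{a \<in> carrier G. fst (\<alpha> a (l, 0)) = l}"
  have shift: "\<alpha> a (l', n) = (fst (\<alpha> a (l', 0)), snd (\<alpha> a (l', 0)) + n)"
    if "a \<in> carrier G" for a l' n
  proof -
    have "\<alpha> a (shift n (l', 0)) = shift n (\<alpha> a (l', 0))"
      using equi[OF that] by (simp add: equivariant_def del: split_paired_All)
    then show ?thesis by (simp add: shift_def)
  qed
  have inv: "\<alpha> a (\<alpha> (inv a) y) = y" "\<alpha> (inv a) (\<alpha> a y) = y" if "a \<in> carrier G" for a y
    using that mult[of a "inv a" y] mult[of "inv a" a y] one by simp_all
  have comp: "fst (\<alpha> (a \<otimes> b) (l, 0)) = fst (\<alpha> a (fst (\<alpha> b (l, 0)), 0))"
    if "a \<in> carrier G" "b \<in> carrier G" for a b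
    using that mult[OF that] shift[of a "fst (\<alpha> b (l, 0))" "snd (\<alpha> b (l, 0))"] by simp
  have inv_fst: "fst (\<alpha> a (fst (\<alpha> (inv a) (l, 0)), 0)) = l" if "a \<in> carrier G" for a
    using comp[of a "inv a"] one that by simp
  have sub: "subgroup ?S G"
  proof (rule subgroupI)
    show "?S \<noteq> {}" using one by (auto intro!: exI[of _ \<one>])
    show "inv a \<in> ?S" if "a \<in> ?S" for a
      using comp[of "inv a" a] one that by auto
    show "a \<otimes> b \<in> ?S" if "a \<in> ?S" "b \<in> ?S" for a b
      using comp[of a b] that by auto
  qed auto
  show "finite_index ?S G"
  proof (rule finite_indexI[OF sub])
    \<comment> \<open>Inverses enter because right cosets of the stabiliser correspond to orbit
      points through \<open>inv a\<close> rather than \<open>a\<close>.\<close>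
    have "length (fst (\<alpha> (inv a) (l, 0))) = length l" if "a \<in> carrier G" for a
      using equi[of "inv a"] that by (simp add: equivariant_def)
    then have "(\<lambda>a. fst (\<alpha> (inv a) (l, 0))) ` carrier G \<subseteq> {l'. set l' \<subseteq> UNIV \<and> length l' = length l}"
      by auto
    then show "finite ((\<lambda>a. fst (\<alpha> (inv a) (l, 0))) ` carrier G)"
      by (rule finite_subset) (simp only: finite_lists_length_eq finite)
    fix a b assume "a \<in> carrier G" "b \<in> carrier G"
      "fst (\<alpha> (inv a) (l, 0)) = fst (\<alpha> (inv b) (l, 0))"
    then show "a \<otimes> inv b \<in> ?S" using comp[of a "inv b"] inv_fst[of a] by simp
  qed
  show "integer_character ?S G (\<lambda>a. snd (\<alpha> a (l, 0)))"
    unfolding integer_character_def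
  proof (intro ballI)
    fix a b assume "a \<in> ?S" "b \<in> ?S"
    then have "a \<in> carrier G" "b \<in> carrier G" "\<alpha> b (l, 0) = (l, snd (\<alpha> b (l, 0)))"
      by (auto simp: prod_eq_iff)
    then show "snd (\<alpha> (a \<otimes> b) (l, 0)) = snd (\<alpha> a (l, 0)) + snd (\<alpha> b (l, 0))"
      using mult[of a b] shift[of a l "snd (\<alpha> b (l, 0))"] by simp
  qed
qed

text \<open>The map onto the group of order 2 that counts letters of type \<open>\<tau>\<close>,
  realised on lists of bits.\<close>

definition type_flip :: "'v \<Rightarrow> 'v \<times> bool list \<Rightarrow> bool list \<times> int \<Rightarrow> bool list \<times> int" where
  "type_flip \<tau> s y = (if fst s = \<tau> then (map Not (fst y), snd y) else y)"

lemma lattice_action_type_flip: "lattice_action D (type_flip \<tau>)"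
  by (auto simp: lattice_action_def cox_action_def equivariant_def type_flip_def shift_def o_def)

lemma foldr_type_flip:
  "foldr (type_flip \<tau>) w ([b], n) = ([b = even (length (filter (\<lambda>s. fst s = \<tau>) w))], n)"
  by (induction w) (auto simp: type_flip_def)

lemma foldr_commute:
  assumes "cox_action D g" "\<And>s t. s \<in> set w \<Longrightarrow> t \<in> set w' \<Longrightarrow> (s, t) \<in> D"
  shows "foldr g w (foldr g w' y) = foldr g w' (foldr g w y)"
proof -
  have *: "g s (foldr g w' y) = foldr g w' (g s y)" if "s \<in> set w" for s y
  proof -
    have "\<And>t. t \<in> set w' \<Longrightarrow> (s, t) \<in> D" using assms(2) that by blast
    then show ?thesis
      by (induction w') (auto simp: cox_actionD(2)[OF assms(1)])
  qed
  then show ?thesis by (induction w) auto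
qed

text \<open>A homomorphism \<open>r\<close> from the graph product to a right-angled Coxeter group whose injectivity is
  witnessed by an action \<open>g\<close> of the latter extending left multiplication.\<close>

locale coxeter_cover = graph_of_groups V E F
  for V :: "'v set" and E :: "('v \<times> 'v) set" and F :: "'v \<Rightarrow> 'b monoid" +
  fixes r :: "'v \<times> 'b \<Rightarrow> ('v \<times> bool list) list"
    and g :: "'v \<times> bool list \<Rightarrow> ('v \<times> 'b) list set set \<Rightarrow> ('v \<times> 'b) list set set"
  assumes r_type: "s \<in> set (r (v, a)) \<Longrightarrow> fst s = v"
    and r_one: "v \<in> V \<Longrightarrow> r (v, \<one>\<^bsub>F v\<^esub>) = []"
    and r_mult: "cox_action {(s, t). (fst s, fst t) \<in> E} (p :: _ \<Rightarrow> bool list \<times> int \<Rightarrow> bool list \<times> int) \<Longrightarrow> v \<in> V \<Longrightarrow>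
      a \<in> carrier (F v) \<Longrightarrow> b \<in> carrier (F v) \<Longrightarrow>
      foldr p (r (v, a \<otimes>\<^bsub>F v\<^esub> b)) z = foldr p (r (v, a)) (foldr p (r (v, b)) z)"
    and g_action: "cox_action {(s, t). (fst s, fst t) \<in> E} g"
    and g_word: "v \<in> V \<Longrightarrow> a \<in> carrier (F v) \<Longrightarrow> y \<in> carrier A \<Longrightarrow>
      foldr g (r (v, a)) y = word [(v, a)] \<otimes>\<^bsub>A\<^esub> y"
begin

abbreviation "D \<equiv> {(s :: 'v \<times> bool list, t :: 'v \<times> bool list). (fst s, fst t) \<in> E}"

definition R :: "('v \<times> 'b) list \<Rightarrow> ('v \<times> bool list) list" where
  "R w = concat (map r w)"

lemma foldr_R: "foldr p (R w) = foldr (\<lambda>s. foldr p (r s)) w"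
  by (induction w) (auto simp: R_def)

lemma R_append: "R (w @ w') = R w @ R w'"
  by (simp add: R_def)

text \<open>Evaluation at the identity recovers \<open>word w\<close>; this brings triviality of
  \<open>R w\<close> under all actions back to \<open>A\<close>.\<close>

lemma foldr_g_R: "w \<in> free_words V F \<Longrightarrow> foldr g (R w) \<one>\<^bsub>A\<^esub> = word w"
proof (induction w)
  case (Cons s w)
  then have "foldr g (R (s # w)) \<one>\<^bsub>A\<^esub> = word [s] \<otimes>\<^bsub>A\<^esub> word w"
    using g_word[of "fst s" "snd s" "word w"] word_closed by (simp add: R_def)
  also have "\<dots> = word (s # w)" using Cons.prems word_append[of "[s]" w] by simp
  finally show ?case .
qed (simp add: R_def word_Nil)

text \<open>\<open>R\<close> respects the edge relations: for an edge \<open>(u, v)\<close>, the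
  letters of \<open>r (u, a)\<close> have type \<open>u\<close> and those of \<open>r (v, b)\<close>
  type \<open>v\<close>, so all of them are adjacent in \<open>D\<close>.\<close>

lemma foldr_R_cong:
  assumes "cox_action D (p :: _ \<Rightarrow> bool list \<times> int \<Rightarrow> bool list \<times> int)"
    and "w \<in> free_words V F" "w' \<in> free_words V F" "word w = word w'"
  shows "foldr p (R w) = foldr p (R w')"
  unfolding foldr_R
proof (rule foldr_word_cong[OF _ _ _ assms(2-4)])
  show "foldr p (r (u, a)) (foldr p (r (v, b)) y) = foldr p (r (v, b)) (foldr p (r (u, a)) y)"
    if "(u, v) \<in> E" for u v a b y
    using that r_type by (intro foldr_commute[OF assms(1)]) auto
qed (use r_one r_mult[OF assms(1)] in auto)

definition act :: "('v \<times> bool list \<Rightarrow> bool list \<times> int \<Rightarrow> bool list \<times> int)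
    \<Rightarrow> ('v \<times> 'b) list set set \<Rightarrow> bool list \<times> int \<Rightarrow> bool list \<times> int" where
  "act p a = foldr p (R (SOME w. w \<in> free_words V F \<and> word w = a))"

lemma act_word:
  assumes "cox_action D p" "w \<in> free_words V F"
  shows "act p (word w) = foldr p (R w)"
  unfolding act_def
  by (rule someI2[of "\<lambda>w'. w' \<in> free_words V F \<and> word w' = word w" w])
    (use assms in \<open>auto intro: foldr_R_cong\<close>)

lemma stabilizer_act:
  assumes "lattice_action D p"
  shows "finite_index {a \<in> carrier A. fst (act p a (l, 0)) = l} A"
    and "integer_character {a \<in> carrier A. fst (act p a (l, 0)) = l} A (\<lambda>a. snd (act p a (l, 0)))"
proof -
  have p: "cox_action D p" and eq: "\<And>s. equivariant (p s)"
    using assms unfolding lattice_action_def by blast+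
  have mult: "act p (a \<otimes>\<^bsub>A\<^esub> b) y = act p a (act p b y)" if "a \<in> carrier A" "b \<in> carrier A" for a b y
    using that by (auto simp: carrier_graph_product word_append act_word[OF p] R_append)
  have one: "act p \<one>\<^bsub>A\<^esub> y = y" for y
    using act_word[OF p, of "[]"] by (simp add: word_Nil R_def)
  have equi: "equivariant (act p a)" for a
    unfolding act_def using eq by (rule equivariant_foldr)
  show "finite_index {a \<in> carrier A. fst (act p a (l, 0)) = l} A"
    using mult one equi by (rule A.stabilizer_character)
  show "integer_character {a \<in> carrier A. fst (act p a (l, 0)) = l} A (\<lambda>a. snd (act p a (l, 0)))"
    using mult one equi by (rule A.stabilizer_character)
qed

text \<open>A nonzero translation by \<open>R w\<close> would give a detecting character on the
  stabiliser of a list. If there is none, \<open>R w\<close> acts trivially under \<open>g\<close>,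
  and evaluation at the identity gives \<open>word w\<close> equal to the identity.\<close>

lemma virtually_detected_word:
  assumes w: "w \<in> free_words V F" and even: "typewise_even (R w)" and ne: "word w \<noteq> \<one>\<^bsub>A\<^esub>"
  shows "virtually_detected A (word w)"
proof (rule ccontr)
  assume contr: "\<not> virtually_detected A (word w)"
  have "foldr g (R w) \<one>\<^bsub>A\<^esub> = \<one>\<^bsub>A\<^esub>"
  proof (rule trivial_or_translation[OF _ _ even _ g_action])
    show "sym D" using sym_E by (auto simp: sym_def)
    show "fst s \<noteq> fst t" if "(s, t) \<in> D" for s t using that edgeD by auto
    fix p l n assume p: "lattice_action D p" and n: "foldr p (R w) (l, 0) = (l, n)"
    have "cox_action D p" using p unfolding lattice_action_def by blast
    then have act: "act p (word w) (l, 0) = (l, n)" using w n by (simp add: act_word)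
    show "n = 0"
    proof (rule ccontr)
      assume "n \<noteq> 0"
      have "virtually_detected A (word w)"
        unfolding virtually_detected_def
        by (intro exI conjI, rule stabilizer_act(1)[OF p, of l], rule stabilizer_act(2)[OF p, of l])
          (use act word_closed[OF w] \<open>n \<noteq> 0\<close> in simp_all)
      with contr show False ..
    qed
  qed
  with foldr_g_R[OF w] ne show False by simp
qed

text \<open>If all types are even, detection applies. An odd type moves the one-bit list
  \<open>[True]\<close> under \<open>type_flip\<close>, so the stabiliser of that list excludes
  \<open>x\<close>.\<close>

lemma residually_finite_graph_product: "residually_finite A"
  unfolding residually_finite_def
proof (intro ballI impI)
  fix x assume "x \<in> carrier A" "x \<noteq> \<one>\<^bsub>A\<^esub>"
  then obtain w where w: "w \<in> free_words V F" "x = word w" "word w \<noteq> \<one>\<^bsub>A\<^esub>"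
    by (auto simp: carrier_graph_product)
  show "\<exists>K. finite_index K A \<and> x \<notin> K"
  proof (cases "typewise_even (R w)")
    case True
    with w show ?thesis
      using virtually_detected_word A.virtually_detected_imp_excluded by blast
  next
    case False
    then obtain \<tau> where odd: "odd (length (filter (\<lambda>s. fst s = \<tau>) (R w)))"
      by (auto simp: typewise_even_def)
    have p: "lattice_action D (type_flip \<tau>)" by (rule lattice_action_type_flip)
    then have "cox_action D (type_flip \<tau>)" unfolding lattice_action_def by blast
    then have "fst (act (type_flip \<tau>) x ([True], 0)) \<noteq> [True]"
      using odd w by (simp add: act_word foldr_type_flip)
    with stabilizer_act(1)[OF p, of "[True]"] show ?thesis by blast
  qed
qed

lemma virtually_detected_square:
  assumes "x \<in> carrier A" "x \<otimes>\<^bsub>A\<^esub> x \<noteq> \<one>\<^bsub>A\<^esub>"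
  shows "virtually_detected A (x \<otimes>\<^bsub>A\<^esub> x)"
proof -
  obtain w where w: "w \<in> free_words V F" "x = word w"
    using assms(1) by (auto simp: carrier_graph_product)
  have "typewise_even (R (w @ w))" by (simp add: R_append typewise_even_def)
  with w assms(2) show ?thesis using virtually_detected_word[of "w @ w"] by (simp add: word_append)
qed

end

section \<open>Right-angled Coxeter groups\<close>

context graph_of_groups
begin

lemma coxeter_cover_Coxeter:
  assumes Z2: "\<And>v. v \<in> V \<Longrightarrow> F v \<cong> integer_mod_group 2"
  shows "\<exists>r g. coxeter_cover V E F r g"
proof -
  have two: "\<exists>c. carrier (F v) = {\<one>\<^bsub>F v\<^esub>, c} \<and> c \<noteq> \<one>\<^bsub>F v\<^esub> \<and> c \<otimes>\<^bsub>F v\<^esub> c = \<one>\<^bsub>F v\<^esub>" if v: "v \<in> V" for v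
  proof -
    interpret Fv: group "F v" using group_vertex v .
    obtain h where h: "h \<in> iso (F v) (integer_mod_group 2)" using Z2[OF v] by (auto simp: is_iso_def)
    interpret h: group_hom "F v" "integer_mod_group 2" h
      using h by (auto simp: group_hom_def group_hom_axioms_def iso_def)
    have "carrier (integer_mod_group 2) = {0, 1}" by (auto simp: integer_mod_group_def)
    then have bij: "bij_betw h (carrier (F v)) {0, 1}" using h by (simp add: iso_def)
    then have "1 \<in> h ` carrier (F v)" by (simp add: bij_betw_def)
    then obtain c where c: "c \<in> carrier (F v)" "h c = 1" by (metis imageE)
    have h1: "h \<one>\<^bsub>F v\<^esub> = 0" using h.hom_one by simp
    have inj: "x = y" if "h x = h y" "x \<in> carrier (F v)" "y \<in> carrier (F v)" for x y
      using bij_betw_imp_inj_on[OF bij] that by (rule inj_onD)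
    have "x = \<one>\<^bsub>F v\<^esub> \<or> x = c" if "x \<in> carrier (F v)" for x
    proof -
      have "h x = 0 \<or> h x = 1" using bij_betwE[OF bij] that by blast
      then show ?thesis using inj[OF _ that] c h1 Fv.one_closed by metis
    qed
    then have "carrier (F v) = {\<one>\<^bsub>F v\<^esub>, c}" using c by auto
    moreover have "c \<otimes>\<^bsub>F v\<^esub> c = \<one>\<^bsub>F v\<^esub>"
    proof (rule inj)
      show "h (c \<otimes>\<^bsub>F v\<^esub> c) = h \<one>\<^bsub>F v\<^esub>" using h.hom_mult[OF c(1) c(1)] c h1 by simp
    qed (use c in simp_all)
    moreover have "c \<noteq> \<one>\<^bsub>F v\<^esub>" using c(2) h1 by (metis zero_neq_one)
    ultimately show ?thesis by blast
  qed
  then obtain c where c: "\<And>v. v \<in> V \<Longrightarrow>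
      carrier (F v) = {\<one>\<^bsub>F v\<^esub>, c v} \<and> c v \<noteq> \<one>\<^bsub>F v\<^esub> \<and> c v \<otimes>\<^bsub>F v\<^esub> c v = \<one>\<^bsub>F v\<^esub>" by metis
  have c: "c v \<in> carrier (F v)" "c v \<noteq> \<one>\<^bsub>F v\<^esub>" "c v \<otimes>\<^bsub>F v\<^esub> c v = \<one>\<^bsub>F v\<^esub>"
      "a \<in> carrier (F v) \<Longrightarrow> a = \<one>\<^bsub>F v\<^esub> \<or> a = c v" if "v \<in> V" for v a
    using c[OF that] by blast+
  define r :: "'v \<times> 'b \<Rightarrow> ('v \<times> bool list) list" where
    "r s = (if snd s = \<one>\<^bsub>F (fst s)\<^esub> then [] else [(fst s, [])])" for s
  \<comment> \<open>Every vertex of type \<open>v\<close> acts as left multiplication by the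
    involution \<open>c v\<close>, whatever its list. Outside the carrier \<open>g\<close> is the
    identity, so that its laws hold on the whole type.\<close>
  define g :: "'v \<times> bool list \<Rightarrow> ('v \<times> 'b) list set set \<Rightarrow> ('v \<times> 'b) list set set" where
    "g s y = (if fst s \<in> V \<and> y \<in> carrier A then word [(fst s, c (fst s))] \<otimes>\<^bsub>A\<^esub> y else y)" for s y
  have cw: "word [(v, c v)] \<in> carrier A" if "v \<in> V" for v
    using c(1)[OF that] that by (intro word_closed) simp
  have cc: "word [(v, c v)] \<otimes>\<^bsub>A\<^esub> word [(v, c v)] = \<one>\<^bsub>A\<^esub>" if "v \<in> V" for v
    using c(1,3)[OF that] that by (simp add: word_mult word_one)
  have "coxeter_cover V E F r g"
  proof (unfold_locales)
    show "fst s = v" if "s \<in> set (r (v, a))" for s v a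
      using that by (auto simp: r_def split: if_splits)
    show "r (v, \<one>\<^bsub>F v\<^esub>) = []" for v by (simp add: r_def)
    show "foldr p (r (v, a \<otimes>\<^bsub>F v\<^esub> b)) y = foldr p (r (v, a)) (foldr p (r (v, b)) y)"
      if "cox_action {(s, t). (fst s, fst t) \<in> E} p" "v \<in> V" "a \<in> carrier (F v)" "b \<in> carrier (F v)"
      for p :: "'v \<times> bool list \<Rightarrow> bool list \<times> int \<Rightarrow> bool list \<times> int" and v a b y
    proof -
      interpret Fv: group "F v" using group_vertex that(2) .
      have "a = \<one>\<^bsub>F v\<^esub> \<or> a = c v" "b = \<one>\<^bsub>F v\<^esub> \<or> b = c v" using c(4)[OF that(2)] that by auto
      then show ?thesis
        using c(1-3)[OF that(2)] that(3,4) cox_actionD(1)[OF that(1)] by (auto simp: r_def)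
    qed
    show "cox_action {(s, t). (fst s, fst t) \<in> E} g"
      unfolding cox_action_def
    proof (intro conjI allI impI)
      fix s y show "g s (g s y) = y"
        using cw cc by (simp add: g_def flip: A.m_assoc)
    next
      fix s t :: "'v \<times> bool list" and y assume st: "(s, t) \<in> {(s, t). (fst s, fst t) \<in> E}"
      then have V: "fst s \<in> V" "fst t \<in> V" using edgeD by auto
      have "word [(fst s, c (fst s))] \<otimes>\<^bsub>A\<^esub> word [(fst t, c (fst t))] =
          word [(fst t, c (fst t))] \<otimes>\<^bsub>A\<^esub> word [(fst s, c (fst s))]"
        using st c(1)[OF V(1)] c(1)[OF V(2)] by (intro word_commute) auto
      then show "g s (g t y) = g t (g s y)"
        using V cw by (simp add: g_def flip: A.m_assoc)
    qed
    show "foldr g (r (v, a)) y = word [(v, a)] \<otimes>\<^bsub>A\<^esub> y"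
      if "v \<in> V" "a \<in> carrier (F v)" "y \<in> carrier A" for v a y
      using c(2)[OF that(1)] c(4)[OF that(1,2)] that by (auto simp: r_def g_def word_one)
  qed
  then show ?thesis by blast
qed

end

section \<open>Right-angled Artin groups and generator-inverting automorphisms\<close>

text \<open>The \<open>k\<close>-th power of the product of the involutions \<open>(v, [True])\<close> and \<open>(v, [])\<close>.\<close>

definition dihedral_word :: "'v \<Rightarrow> int \<Rightarrow> ('v \<times> bool list) list" where
  "dihedral_word v k =
     (if k \<ge> 0 then concat (replicate (nat k) [(v, [True]), (v, [])])
      else concat (replicate (nat (- k)) [(v, []), (v, [True])]))"

lemma fst_dihedral_word: "s \<in> set (dihedral_word v k) \<Longrightarrow> fst s = v"
  by (auto simp: dihedral_word_def split: if_splits)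

lemma foldr_dihedral_word_succ:
  assumes "cox_action D g"
  shows "foldr g (dihedral_word v (k + 1)) y = g (v, [True]) (g (v, []) (foldr g (dihedral_word v k) y))"
proof (cases "k \<ge> 0")
  case True
  then have "nat (k + 1) = Suc (nat k)" by simp
  with True show ?thesis by (simp add: dihedral_word_def)
next
  case False
  then have "nat (- k) = Suc (nat (- (k + 1)))" by simp
  with False have "dihedral_word v k = [(v, []), (v, [True])] @ dihedral_word v (k + 1)"
    by (cases "k = - 1") (simp_all add: dihedral_word_def)
  then show ?thesis by (simp add: cox_actionD(1)[OF assms])
qed

lemma foldr_dihedral_word_add:
  assumes "cox_action D g"
  shows "foldr g (dihedral_word v (i + j)) y = foldr g (dihedral_word v i) (foldr g (dihedral_word v j) y)"
proof (induction i rule: int_induct[where k = 0])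
  case base
  then show ?case by (simp add: dihedral_word_def)
next
  case (step1 i)
  have "i + 1 + j = (i + j) + 1" by simp
  then show ?case using step1(2) by (simp only: foldr_dihedral_word_succ[OF assms])
next
  case (step2 i)
  \<comment> \<open>The product of the two involutions acts injectively, which allows the induction
    to descend to negative integers.\<close>
  have cancel: "y = z" if "g (v, [True]) (g (v, []) y) = g (v, [True]) (g (v, []) z)" for y z
    using that cox_actionD(1)[OF assms] by metis
  have eqs: "i + j = (i - 1 + j) + 1" "i = (i - 1) + 1" by simp_all
  show ?case
    by (rule cancel) (use step2(2) in
      \<open>simp add: foldr_dihedral_word_succ[OF assms, symmetric] add.commute[of j]\<close>)
qed

context graph_of_groups
begin

definition invert_letter :: "'v \<Rightarrow> 'v \<times> 'b \<Rightarrow> 'v \<times> 'b" where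
  "invert_letter v s = (fst s, if fst s = v then inv\<^bsub>F (fst s)\<^esub> (snd s) else snd s)"

definition invert :: "'v \<Rightarrow> ('v \<times> 'b) list set set \<Rightarrow> ('v \<times> 'b) list set set" where
  "invert v a = word (map (invert_letter v) (SOME w. w \<in> free_words V F \<and> word w = a))"

lemma invert_letter_closed:
  assumes "w \<in> free_words V F"
  shows "map (invert_letter v) w \<in> free_words V F"
  using assms group.inv_closed[OF group_vertex] by (induction w) (auto simp: invert_letter_def)

lemma invert_letter_invol:
  assumes "w \<in> free_words V F"
  shows "map (invert_letter v) (map (invert_letter v) w) = w"
  using assms group.inv_inv[OF group_vertex] by (induction w) (auto simp: invert_letter_def)

lemma invert_letter_commute:
  "map (invert_letter u) (map (invert_letter v) w) = map (invert_letter v) (map (invert_letter u) w)"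
  by (auto simp: invert_letter_def)

lemma word_Cons:
  assumes "s # w \<in> free_words V F"
  shows "word (s # w) = word [s] \<otimes>\<^bsub>A\<^esub> word w"
  using assms word_append[of "[s]" w] by simp

text \<open>This makes \<open>invert\<close> well defined. Letters act by left multiplication by
  their inverted forms, which respects products because vertex groups are abelian; the action is
  then evaluated at the identity.\<close>

lemma word_map_invert_letter_cong:
  assumes comm: "\<And>u. u \<in> V \<Longrightarrow> comm_group (F u)"
    and w: "w \<in> free_words V F" "w' \<in> free_words V F" "word w = word w'"
  shows "word (map (invert_letter v) w) = word (map (invert_letter v) w')"
proof -
  let ?f = "\<lambda>s y. if y \<in> carrier A then word [invert_letter v s] \<otimes>\<^bsub>A\<^esub> y else y"
  have letter: "[invert_letter v (u, a)] \<in> free_words V F" if "u \<in> V" "a \<in> carrier (F u)" for u a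
    using invert_letter_closed[of "[(u, a)]" v] that by simp
  have foldr: "foldr ?f x \<one>\<^bsub>A\<^esub> = word (map (invert_letter v) x)" if "x \<in> free_words V F" for x
    using that
  proof (induction x)
    case (Cons s x)
    have "map (invert_letter v) (s # x) \<in> free_words V F" using Cons.prems by (rule invert_letter_closed)
    then show ?case using Cons word_Cons[of "invert_letter v s" "map (invert_letter v) x"]
      by (simp add: word_closed)
  qed (simp add: word_Nil)
  have "foldr ?f w = foldr ?f w'"
  proof (rule foldr_word_cong[OF _ _ _ w])
    fix u y assume u: "u \<in> V"
    interpret Fu: comm_group "F u" using comm u .
    show "?f (u, \<one>\<^bsub>F u\<^esub>) y = y"
      using word_one[OF u] by (cases "v = u") (auto simp: invert_letter_def)
    fix a b assume ab: "a \<in> carrier (F u)" "b \<in> carrier (F u)"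
    have "invert_letter v (u, a \<otimes>\<^bsub>F u\<^esub> b) =
        (u, snd (invert_letter v (u, a)) \<otimes>\<^bsub>F u\<^esub> snd (invert_letter v (u, b)))"
      using ab by (cases "v = u") (auto simp: invert_letter_def Fu.inv_mult)
    moreover have "snd (invert_letter v (u, c)) \<in> carrier (F u)" if "c \<in> carrier (F u)" for c
      using that by (cases "v = u") (auto simp: invert_letter_def)
    ultimately have "word [invert_letter v (u, a \<otimes>\<^bsub>F u\<^esub> b)] =
        word [invert_letter v (u, a)] \<otimes>\<^bsub>A\<^esub> word [invert_letter v (u, b)]"
      using u ab by (simp add: word_mult[symmetric]) (simp add: invert_letter_def)
    then show "?f (u, a \<otimes>\<^bsub>F u\<^esub> b) y = ?f (u, a) (?f (u, b) y)"
      using letter[OF u ab(1)] letter[OF u ab(2)] by (simp add: word_closed A.m_assoc)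
  next
    fix u u' a b y assume e: "(u, u') \<in> E" and ab: "a \<in> carrier (F u)" "b \<in> carrier (F u')"
    have V: "u \<in> V" "u' \<in> V" using edgeD e by auto
    let ?x = "word [invert_letter v (u, a)]" and ?y = "word [invert_letter v (u', b)]"
    have "?x \<otimes>\<^bsub>A\<^esub> ?y = ?y \<otimes>\<^bsub>A\<^esub> ?x"
      using letter[OF V(1) ab(1)] letter[OF V(2) ab(2)] word_commute[OF e]
      by (simp add: invert_letter_def)
    moreover have "?x \<in> carrier A" "?y \<in> carrier A"
      using letter[OF V(1) ab(1)] letter[OF V(2) ab(2)] by (auto intro: word_closed)
    ultimately show "?f (u, a) (?f (u', b) y) = ?f (u', b) (?f (u, a) y)"
      by (simp flip: A.m_assoc)
  qed
  then have "foldr ?f w \<one>\<^bsub>A\<^esub> = foldr ?f w' \<one>\<^bsub>A\<^esub>" by (rule fun_cong)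
  then show ?thesis unfolding foldr[OF w(1)] foldr[OF w(2)] .
qed

lemma coxeter_cover_Artin:
  assumes Z: "\<And>v. v \<in> V \<Longrightarrow> F v \<cong> integer_group"
  shows "\<exists>r g. coxeter_cover V E F r g"
proof -
  have "\<exists>h. h \<in> iso (F v) integer_group" if "v \<in> V" for v using Z[OF that] by (auto simp: is_iso_def)
  then obtain h where h: "\<And>v. v \<in> V \<Longrightarrow> h v \<in> iso (F v) integer_group" by metis
  have h_mult: "h v (a \<otimes>\<^bsub>F v\<^esub> b) = h v a + h v b"
    if "v \<in> V" "a \<in> carrier (F v)" "b \<in> carrier (F v)" for v a b
    using h[OF that(1)] that by (simp add: iso_def hom_def)
  have h_inj: "a = b"
    if "v \<in> V" "h v a = h v b" "a \<in> carrier (F v)" "b \<in> carrier (F v)" for v a b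
  proof -
    have "inj_on (h v) (carrier (F v))" using h[OF that(1)] by (simp add: iso_def bij_betw_def)
    then show ?thesis using that(2-4) by (rule inj_onD)
  qed
  have h_one: "h v \<one>\<^bsub>F v\<^esub> = 0" if "v \<in> V" for v
  proof -
    interpret Fv: group "F v" using group_vertex that .
    show ?thesis using h_mult[OF that, of "\<one>\<^bsub>F v\<^esub>" "\<one>\<^bsub>F v\<^esub>"] by simp
  qed
  have "\<exists>a. a \<in> carrier (F v) \<and> h v a = k" if "v \<in> V" for v k
  proof -
    have "h v ` carrier (F v) = UNIV"
      using h[OF that] by (simp add: iso_def bij_betw_def integer_group_def)
    then show ?thesis by (metis UNIV_I imageE)
  qed
  then obtain e where e: "\<And>v k. v \<in> V \<Longrightarrow> e v k \<in> carrier (F v) \<and> h v (e v k) = k" by metis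
  have e_closed: "e v k \<in> carrier (F v)" if "v \<in> V" for v k using e that by blast
  have e_h: "e v (h v a) = a" if "v \<in> V" "a \<in> carrier (F v)" for v a
    using e that h_inj by blast
  have e_zero: "e v 0 = \<one>\<^bsub>F v\<^esub>" if "v \<in> V" for v
    using e_h[OF that, of "\<one>\<^bsub>F v\<^esub>"] h_one[OF that] group_vertex[OF that]
    by (simp add: group.is_monoid monoid.one_closed)
  have e_add: "e v (i + j) = e v i \<otimes>\<^bsub>F v\<^esub> e v j" if "v \<in> V" for v i j
  proof -
    interpret Fv: group "F v" using group_vertex that .
    show ?thesis using that e[OF that] by (intro h_inj[OF that]) (simp_all add: h_mult)
  qed
  have comm: "comm_group (F v)" if v: "v \<in> V" for v
  proof -
    interpret Fv: group "F v" using group_vertex v .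
    show ?thesis
      by (rule Fv.group_comm_groupI) (rule h_inj[OF v], simp_all add: h_mult[OF v])
  qed
  have inv_word: "invert v (word w) = word (map (invert_letter v) w)" if "w \<in> free_words V F" for v w
  proof -
    let ?w = "SOME w'. w' \<in> free_words V F \<and> word w' = word w"
    have "?w \<in> free_words V F \<and> word ?w = word w"
      by (rule someI[of _ w]) (simp add: that)
    then show ?thesis
      unfolding invert_def using word_map_invert_letter_cong[OF comm, of ?w w] that by blast
  qed
  have wordE: "\<exists>w\<in>free_words V F. y = word w" if "y \<in> carrier A" for y
    using that by (auto simp: carrier_graph_product)
  have inv_closed: "invert v y \<in> carrier A" if "y \<in> carrier A" for v y
  proof -
    obtain w where w: "w \<in> free_words V F" "y = word w" using wordE[OF \<open>y \<in> carrier A\<close>] by blast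
    show ?thesis unfolding w(2) inv_word[OF w(1)] by (rule word_closed[OF invert_letter_closed[OF w(1)]])
  qed
  have inv_mult: "invert v (x \<otimes>\<^bsub>A\<^esub> y) = invert v x \<otimes>\<^bsub>A\<^esub> invert v y"
    if "x \<in> carrier A" "y \<in> carrier A" for v x y
  proof -
    obtain w w' where w: "w \<in> free_words V F" "w' \<in> free_words V F" "x = word w" "y = word w'"
      using wordE[OF \<open>x \<in> carrier A\<close>] wordE[OF \<open>y \<in> carrier A\<close>] by blast
    have "w @ w' \<in> free_words V F" using w by simp
    then show ?thesis
      unfolding w(3,4) word_append[OF w(1,2)] inv_word[OF w(1)] inv_word[OF w(2)]
        word_append[OF invert_letter_closed[OF w(1)] invert_letter_closed[OF w(2)]]
      by (simp add: inv_word)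
  qed
  have inv_invol: "invert v (invert v y) = y" if "y \<in> carrier A" for v y
  proof -
    obtain w where w: "w \<in> free_words V F" "y = word w" using wordE[OF \<open>y \<in> carrier A\<close>] by blast
    show ?thesis
      unfolding w(2) inv_word[OF w(1)] inv_word[OF invert_letter_closed[OF w(1)]]
        invert_letter_invol[OF w(1)] ..
  qed
  have inv_comm: "invert u (invert v y) = invert v (invert u y)" if "y \<in> carrier A" for u v y
  proof -
    obtain w where w: "w \<in> free_words V F" "y = word w" using wordE[OF \<open>y \<in> carrier A\<close>] by blast
    show ?thesis
      unfolding w(2) inv_word[OF w(1)] inv_word[OF invert_letter_closed[OF w(1)]]
      by (rule arg_cong[OF invert_letter_commute])
  qed
  define L where "L v = word [(v, e v 1)]" for v
  have L_free: "[(v, e v k)] \<in> free_words V F" if "v \<in> V" for v k using that e_closed by simp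
  have L_closed: "L v \<in> carrier A" if "v \<in> V" for v
    unfolding L_def by (rule word_closed[OF L_free[OF that]])
  have inv_L: "invert u (L v) = (if u = v then word [(v, e v (- 1))] else L v)" if v: "v \<in> V" for u v
  proof -
    interpret Fv: group "F v" using group_vertex v .
    have "inv\<^bsub>F v\<^esub> (e v 1) = e v (- 1)"
      using e_add[OF v, of "- 1" 1] e_zero[OF v] e_closed[OF v] by (intro Fv.inv_equality) simp_all
    then show ?thesis unfolding L_def inv_word[OF L_free[OF v]] by (simp add: invert_letter_def)
  qed
  \<comment> \<open>This makes inversion followed by left multiplication by \<open>L v\<close> an
    involution: applied twice, it multiplies by \<open>L v\<close> and its inverse.\<close>
  have L_inv: "L v \<otimes>\<^bsub>A\<^esub> invert v (L v) = \<one>\<^bsub>A\<^esub>" if "v \<in> V" for v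
    using that e_add[OF that, of 1 "- 1"] e_closed[OF that]
    by (simp add: inv_L) (simp add: L_def word_mult e_zero word_one flip: e_add)
  have L_comm: "L u \<otimes>\<^bsub>A\<^esub> L v = L v \<otimes>\<^bsub>A\<^esub> L u" if "(u, v) \<in> E" for u v
    unfolding L_def using that e_closed edgeD by (intro word_commute) auto
  define r :: "'v \<times> 'b \<Rightarrow> ('v \<times> bool list) list" where
    "r s = dihedral_word (fst s) (h (fst s) (snd s))" for s
  \<comment> \<open>The empty list inverts the generator, and every other list follows this by left
    multiplication by \<open>L\<close>. The composite in the order of \<open>dihedral_word\<close>
    is thus left multiplication by \<open>L\<close>.\<close>
  define g :: "'v \<times> bool list \<Rightarrow> ('v \<times> 'b) list set set \<Rightarrow> ('v \<times> 'b) list set set" where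
    "g s y = (if fst s \<in> V \<and> y \<in> carrier A
       then if snd s = [] then invert (fst s) y else L (fst s) \<otimes>\<^bsub>A\<^esub> invert (fst s) y
       else y)" for s y
  have g: "cox_action {(s, t). (fst s, fst t) \<in> E} g"
    unfolding cox_action_def
  proof (intro conjI allI impI)
    fix s y show "g s (g s y) = y"
      using L_inv by (auto simp: g_def L_closed inv_closed inv_mult inv_invol simp flip: A.m_assoc)
  next
    fix s t :: "'v \<times> bool list" and y assume "(s, t) \<in> {(s, t). (fst s, fst t) \<in> E}"
    then have st: "(fst s, fst t) \<in> E" by simp
    then have V: "fst s \<in> V" "fst t \<in> V" "fst s \<noteq> fst t" using edgeD by auto
    \<comment> \<open>Each inversion fixes the generator of the other vertex, which leaves only the
      commutation of the two \<open>L\<close>.\<close>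
    show "g s (g t y) = g t (g s y)"
      using V L_comm[OF st] inv_comm[of y "fst s" "fst t"]
      by (auto simp: g_def L_closed inv_closed inv_mult inv_L simp flip: A.m_assoc)
  qed
  have g_dihedral: "foldr g (dihedral_word v k) y = word [(v, e v k)] \<otimes>\<^bsub>A\<^esub> y"
    if v: "v \<in> V" and y: "y \<in> carrier A" for v k y
  proof -
    have step: "g (v, [True]) (g (v, []) z) = L v \<otimes>\<^bsub>A\<^esub> z" if "z \<in> carrier A" for z
      using that v by (simp add: g_def inv_closed inv_invol)
    have closed: "foldr g w y \<in> carrier A" for w
      using y by (induction w) (auto simp: g_def L_closed inv_closed)
    have succ: "foldr g (dihedral_word v (k + 1)) y = L v \<otimes>\<^bsub>A\<^esub> foldr g (dihedral_word v k) y" for k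
      unfolding foldr_dihedral_word_succ[OF g] by (rule step[OF closed])
    have w: "word [(v, e v k)] \<in> carrier A" for k by (rule word_closed[OF L_free[OF v]])
    have wsucc: "word [(v, e v (k + 1))] \<otimes>\<^bsub>A\<^esub> y = L v \<otimes>\<^bsub>A\<^esub> (word [(v, e v k)] \<otimes>\<^bsub>A\<^esub> y)" for k
    proof -
      have "word [(v, e v (k + 1))] = L v \<otimes>\<^bsub>A\<^esub> word [(v, e v k)]"
        unfolding L_def using v e_closed by (simp add: word_mult add.commute[of k] flip: e_add)
      then show ?thesis using w y L_closed[OF v] by (simp add: A.m_assoc)
    qed
    show ?thesis
    proof (induction k rule: int_induct[where k = 0])
      case base
      then show ?case using v y by (simp add: dihedral_word_def e_zero word_one)
    next
      case (step1 k)
      then show ?case by (simp add: succ wsucc)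
    next
      case (step2 k)
      then have "L v \<otimes>\<^bsub>A\<^esub> foldr g (dihedral_word v (k - 1)) y = L v \<otimes>\<^bsub>A\<^esub> (word [(v, e v (k - 1))] \<otimes>\<^bsub>A\<^esub> y)"
        using succ[of "k - 1"] wsucc[of "k - 1"] by simp
      then show ?case using closed w y L_closed[OF v] by simp
    qed
  qed
  have "coxeter_cover V E F r g"
  proof (unfold_locales)
    show "fst s = v" if "s \<in> set (r (v, a))" for s v a
      using that fst_dihedral_word by (simp add: r_def)
    show "r (v, \<one>\<^bsub>F v\<^esub>) = []" if "v \<in> V" for v
      using that by (simp add: r_def h_one dihedral_word_def)
    show "foldr p (r (v, a \<otimes>\<^bsub>F v\<^esub> b)) y = foldr p (r (v, a)) (foldr p (r (v, b)) y)"
      if "cox_action {(s, t). (fst s, fst t) \<in> E} p" "v \<in> V" "a \<in> carrier (F v)" "b \<in> carrier (F v)"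
      for p :: "'v \<times> bool list \<Rightarrow> bool list \<times> int \<Rightarrow> bool list \<times> int" and v a b y
      using that by (simp add: r_def h_mult foldr_dihedral_word_add[OF that(1)])
    show "foldr g (r (v, a)) y = word [(v, a)] \<otimes>\<^bsub>A\<^esub> y"
      if "v \<in> V" "a \<in> carrier (F v)" "y \<in> carrier A" for v a y
      using that by (simp add: r_def g_dihedral e_h)
  qed (rule g)
  then show ?thesis by blast
qed

end

theorem corollary1p6:
  fixes G :: "('g, 'm) monoid_scheme"
    and H :: "'g set"
    and A :: "('v \<times> 'b) list set set monoid"
  assumes "group G"
    and "subgroup H G"
    and "finite (rcosets\<^bsub>G\<^esub> H)"
    and "right_angled_Artin_group A \<or> right_angled_Coxeter_group A"
    and "mon (G\<lparr>carrier := H\<rparr>) A \<noteq> {}"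
  shows "property_VRC G"
proof -
  obtain f where f: "f \<in> mon (G\<lparr>carrier := H\<rparr>) A" using assms(5) by blast
  obtain V E F where A: "A = graph_product V E F" and G: "graph_of_groups V E F"
    and F: "(\<forall>v\<in>V. F v \<cong> integer_group) \<or> (\<forall>v\<in>V. F v \<cong> integer_mod_group 2)"
    using assms(4) unfolding right_angled_Artin_group_def right_angled_Coxeter_group_def graph_of_groups_def
    by blast
  interpret graph_of_groups V E F by (rule G)
  obtain r g where "coxeter_cover V E F r g"
    using F coxeter_cover_Artin coxeter_cover_Coxeter by blast
  then interpret coxeter_cover V E F r g .
  show ?thesis
    using assms(1) A.group_axioms _ f[unfolded A] residually_finite_graph_product virtually_detected_square
    by (rule property_VRC_finite_index_embedding) (use assms(2,3) in \<open>simp_all add: finite_index_def\<close>)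
qed

end
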